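(* Let $\nu$ be an infinite cardinal and let $\mu:=\beth_\omega(\nu)$. Let $V$ be a set of cardinality $|V|>\mu$ and suppose $F:\mathcal P(V)\to\mathcal P(V)$ is an anti-monotone function. If there exists a cardinal $\rho\ge\mu$ such that $\rho<|V|$ and $|F(Y)|\le\rho$ for every $Y\in[V]^\nu$, then $V$ is $K_{F,\mu}$-filtrable.
   Context: Work in ZFC. $\beth_0(\nu)=\nu$, $\beth_{n+1}(\nu)=2^{\beth_n(\nu)}$, $\beth_\omega(\nu)=\sup_{n<\omega}\beth_n(\nu)$. $[X]^\kappa$ is the collection of subsets of $X$ of cardinality $\kappa$. A function $F:\mathcal P(V)\to\mathcal P(V)$ is anti-monotone if $A\subseteq B\subseteq V$ implies $F(B)\subseteq F(A)$. For a cardinal $\kappa$, a set $D\subseteq V$ is $K_{F,\kappa}$-closed (equivalently, $F_\kappa$-closed) if $F(Y)\subseteq D$ for every $Y\in[D]^\kappa$. ($K_{F,\kappa}$ denotes the corresponding operator, $K_{F,\kappa}(A)$ being the intersection of all $F_\kappa$-closed sets $D$ with $A\subseteq D\subseteq V$.) A filtration of an infinite set $V$ is a sequence of sets $\langle D_\alpha:\alpha<\kappa\rangle$, for some cardinal $\kappa$, such that: (a) $|D_\alpha|<|V|$ for each $\alpha<\kappa$; (b) $\alpha<\beta<\kappa$ implies $D_\alpha\subseteq D_\beta$; (c) $D_\alpha=\bigcup_{\beta<\alpha}D_\beta$ for limit $\alpha<\kappa$; (d) $V=\bigcup_{\alpha<\kappa}D_\alpha$. $V$ is $K_{F,\mu}$-filtrable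 if there is a filtration of $V$ each of whose members $D_\alpha$ is $K_{F,\mu}$-closed. *)

theory Defs
  imports Main
begin

unbundle cardinal_syntax

text \<open>
  Cardinals are the well-orders \<open>r\<close> with \<open>Card_order r\<close>; they may live on different types and are
  compared by \<open>=o\<close>, \<open>\<le>o\<close>, \<open><o\<close>.
\<close>

text \<open>
  \<open>is_beth_omega \<nu> \<mu>\<close>: the cardinal \<open>\<mu>\<close> is the supremum of \<open>\<nu>\<close>, \<open>2^\<nu>\<close>, \<open>2^(2^\<nu>)\<close>, and so on.
  This is a relation and not a function because the iterated power sets of a type do not all embed
  in one type in general. Every cardinal below \<open>\<mu>\<close> is represented by a well-order on a subset of
  the field of \<open>\<mu>\<close>, so nothing is lost by letting the members \<open>b n\<close> of the sequence and the
  competing upper bounds \<open>\<theta>\<close> range over cardinals on the same type as \<open>\<mu>\<close>.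
\<close>

definition is_beth_omega :: "'n rel \<Rightarrow> 'm rel \<Rightarrow> bool" where
  "is_beth_omega \<nu> \<mu> \<longleftrightarrow> Card_order \<mu> \<and>
     (\<exists>b :: nat \<Rightarrow> 'm rel.
        (\<forall>n. Card_order (b n)) \<and>
        b 0 =o \<nu> \<and>
        (\<forall>n. b (Suc n) =o ctwo ^c b n) \<and>
        (\<forall>n. b n \<le>o \<mu>) \<and>
        (\<forall>\<theta> :: 'm rel. Card_order \<theta> \<longrightarrow> (\<forall>n. b n \<le>o \<theta>) \<longrightarrow> \<mu> \<le>o \<theta>))"

definition subsets_of_card :: "'a set \<Rightarrow> 'k rel \<Rightarrow> 'a set set" where
  "subsets_of_card X \<kappa> = {Y. Y \<subseteq> X \<and> |Y| =o \<kappa>}"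

definition K_closed :: "'a set \<Rightarrow> ('a set \<Rightarrow> 'a set) \<Rightarrow> 'k rel \<Rightarrow> 'a set \<Rightarrow> bool" where
  "K_closed V F \<kappa> D \<longleftrightarrow> D \<subseteq> V \<and> (\<forall>Y \<in> subsets_of_card D \<kappa>. F Y \<subseteq> D)"

text \<open>
  The ordinals below a cardinal \<open>\<kappa>\<close> are the elements of \<open>Field \<kappa>\<close>, and \<open>underS \<kappa> \<alpha>\<close> is the set of
  \<open>\<beta> < \<alpha>\<close>. Limits are nonzero.
\<close>

definition limit_in :: "'k rel \<Rightarrow> 'k \<Rightarrow> bool" where
  "limit_in \<kappa> \<alpha> \<longleftrightarrow> \<alpha> \<in> Field \<kappa> \<and> underS \<kappa> \<alpha> \<noteq> {} \<and>
     (\<forall>\<beta> \<in> underS \<kappa> \<alpha>. \<exists>\<gamma> \<in> underS \<kappa> \<alpha>. \<beta> \<in> underS \<kappa> \<gamma>)"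

definition filtration :: "'a set \<Rightarrow> 'k rel \<Rightarrow> ('k \<Rightarrow> 'a set) \<Rightarrow> bool" where
  "filtration V \<kappa> D \<longleftrightarrow> infinite V \<and> Card_order \<kappa> \<and>
     (\<forall>\<alpha> \<in> Field \<kappa>. |D \<alpha>| <o |V| ) \<and>
     (\<forall>\<beta> \<in> Field \<kappa>. \<forall>\<alpha> \<in> underS \<kappa> \<beta>. D \<alpha> \<subseteq> D \<beta>) \<and>
     (\<forall>\<alpha>. limit_in \<kappa> \<alpha> \<longrightarrow> D \<alpha> = (\<Union>\<beta> \<in> underS \<kappa> \<alpha>. D \<beta>)) \<and>
     V = (\<Union>\<alpha> \<in> Field \<kappa>. D \<alpha>)"

text \<open>
  The length is taken among the cardinals on the type of \<open>V\<close>. This is no restriction: a filtration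
  strictly increases at most \<open>|V|\<close> many times and never reaches \<open>V\<close>, so thinning it out along a
  cofinal continuous subsequence gives a filtration with the same kind of members whose length is a
  cardinal at most \<open>|V|\<close>.
\<close>

definition K_filtrable :: "'a set \<Rightarrow> ('a set \<Rightarrow> 'a set) \<Rightarrow> 'k rel \<Rightarrow> bool" where
  "K_filtrable V F \<mu> \<longleftrightarrow>
     (\<exists>(\<kappa> :: 'a rel) D. filtration V \<kappa> D \<and> (\<forall>\<alpha> \<in> Field \<kappa>. K_closed V F \<mu> (D \<alpha>)))"

end

theory Submission
  imports Defs
begin

text \<open>
  The key is a covering form of Shelah's revised GCH: with \<open>b n = \<beth>\<^sub>n(\<nu>)\<close>, every set \<open>A\<close> has, for some
  \<open>n\<close>, a family of \<open>|A|\<close> sets of size below \<open>\<beth>\<^sub>\<omega>(\<nu>)\<close> such that each subset of \<open>A\<close> of size below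
  \<open>\<beth>\<^sub>\<omega>(\<nu>)\<close> is covered by \<open>b n\<close> of them. It is proved by induction on \<open>|A|\<close>, following Kunen's argument
  that every ordinal is fixed by all but finitely many of the ultrapowers by measures on an
  increasing \<open>\<omega>\<close>-sequence of measurable cardinals: if \<open>n = 0\<close> fails for \<open>A\<close>, some \<open>\<sigma>\<close>-ideal \<open>J\<close> on a
  small set \<open>Y\<close> admits more than \<open>|A|\<close> functions \<open>Y \<rightarrow> A\<close> any two of which agree only on a set in \<open>J\<close>.
  A \<open>J\<close>-minimal function \<open>f\<close> below which there are no fewer than \<open>|A|\<close> such functions has exactly \<open>|A|\<close>
  of them, so \<open>A\<close> is represented modulo \<open>J\<close> in the product of the initial segments below \<open>f y\<close>. These
  segments are smaller than \<open>A\<close>, they can be handled by a common \<open>n\<close> on a \<open>J\<close>-positive set, and for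
  \<open>n\<close> large relative to \<open>|Y|\<close> their coverings combine to one of \<open>A\<close>.

  Given such coverings, closing \<open>A\<close> under \<open>F Y\<close> for the sets \<open>Y\<close> of size \<open>\<nu>\<close> contained in a member of
  the family yields, by anti-monotonicity, a set of size \<open>|A|\<close> closed under \<open>F Y\<close> for all \<open>Y\<close> of size
  above \<open>b n\<close>. If a single \<open>n\<close> serves all \<open>A\<close> with \<open>|A| < |V|\<close>, the hulls of the initial segments of
  \<open>V\<close> form the filtration; otherwise \<open>|V|\<close> has cofinality \<open>\<omega>\<close> and a filtration of length \<open>\<omega>\<close>, where
  no continuity is needed, exists.
\<close>

section \<open>Cardinal arithmetic\<close>

lemma card_of_subset_le: "X \<subseteq> Z \<Longrightarrow> |Z| \<le>o r \<Longrightarrow> |X| \<le>o r"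
  by (rule ordLeq_transitive[OF card_of_mono1])

lemma card_of_Un_le:
  assumes "infinite B" "|X| \<le>o |B|" "|Z| \<le>o |B|"
  shows "|X \<union> Z| \<le>o |B|"
  by (rule card_of_Un_ordLeq_infinite_Field) (use assms in \<open>auto simp: Field_card_of card_of_card_order_on\<close>)

lemma card_of_insert_le:
  assumes "infinite B" "|X| \<le>o |B|"
  shows "|insert a X| \<le>o |B|"
proof -
  have "B \<noteq> {}" using assms(1) by auto
  then show ?thesis using card_of_Un_le[OF assms(1) card_of_singl_ordLeq assms(2), of a] by simp
qed

lemma card_of_Times_le:
  assumes "infinite C" "|A| \<le>o |C|" "|B| \<le>o |C|"
  shows "|A \<times> B| \<le>o |C|"
  by (rule card_of_Sigma_ordLeq_infinite) (use assms in auto)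

lemma card_of_Func_le_Pow:
  fixes Y :: "'i set"
  assumes "infinite Y" "|X| \<le>o |Pow Y|"
  shows "|Func Y X| \<le>o |Pow Y|"
proof -
  have cY: "Cinfinite |Y|" using assms(1) by (simp add: cinfinite_def Field_card_of card_of_card_order_on)
  have pow: "|Pow Y| =o ctwo ^c |Y|"
    using card_of_Pow_Func[of Y] by (simp add: cexp_def ctwo_def Field_card_of)
  have "|Func Y X| = |X| ^c |Y|" by (simp add: cexp_def Field_card_of)
  also have "|X| ^c |Y| \<le>o (ctwo ^c |Y| ) ^c |Y|"
    by (rule cexp_mono1[OF ordLeq_ordIso_trans[OF assms(2) pow] card_of_Card_order])
  also have "(ctwo ^c |Y| ) ^c |Y| =o ctwo ^c ( |Y| *c |Y| )"
    by (rule cexp_cprod[OF Card_order_ctwo])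
  also have "ctwo ^c ( |Y| *c |Y| ) =o ctwo ^c |Y|"
    by (rule cexp_cong2[OF cprod_infinite[OF cY] Card_order_ctwo]) (simp add: Card_order_cprod card_of_Card_order)+
  also have "ctwo ^c |Y| =o |Pow Y|" using pow by (rule ordIso_symmetric)
  finally show ?thesis .
qed

section \<open>Regularity of successor cardinals and ranks of well-founded relations\<close>

text \<open>Successor cardinals are regular: \<open>K\<close> lies in the union of the chain of
  initial segments, hence already in one of them.\<close>

lemma cardSuc_AboveS_nonempty:
  assumes "infinite B" "K \<subseteq> Field (cardSuc |B| )" "|K| \<le>o |B|"
  shows "AboveS (cardSuc |B| ) K \<noteq> {}"
proof -
  let ?s = "cardSuc |B|"
  have Cs: "Card_order ?s" by (simp add: cardSuc_Card_order card_of_Card_order)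
  have wo: "wo_rel ?s" using Cs by (simp add: card_order_on_well_order_on wo_rel_def)
  have "K \<subseteq> (\<Union>i\<in>Field ?s. underS ?s i)"
  proof
    fix x assume "x \<in> K"
    then have "x \<in> Field ?s" using assms(2) by blast
    moreover have "infinite (Field ?s)"
      using assms(1) by (simp add: cardSuc_finite[OF card_of_Card_order] Field_card_of)
    ultimately obtain y where "y \<in> Field ?s" "x \<noteq> y" "(x,y) \<in> ?s"
      using infinite_Card_order_limit[OF Cs] by blast
    then show "x \<in> (\<Union>i\<in>Field ?s. underS ?s i)" by (auto simp: underS_def)
  qed
  moreover have "relChain ?s (underS ?s)"
    unfolding relChain_def using underS_incr[OF wo_rel.TRANS[OF wo] wo_rel.ANTISYM[OF wo]] by blast
  ultimately obtain i where "i \<in> Field ?s" "K \<subseteq> underS ?s i"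
    using cardSuc_UNION[OF card_of_Card_order _ _ _ assms(3), of "underS ?s"] assms(1)
    by (auto simp: Field_card_of)
  then show ?thesis by (auto simp: AboveS_def underS_def)
qed

text \<open>Ranks stay below the successor of \<open>|B|\<close>, because that cardinal is regular
  and a member of \<open>H\<close> has at most \<open>|B|\<close> predecessors in \<open>H\<close>.
  So there are at most \<open>|E|\<close> levels, and each level is an antichain.\<close>

lemma card_le_if_small_segments_and_antichains:
  fixes H :: "'h set" and less :: "'h \<Rightarrow> 'h \<Rightarrow> bool"
  assumes wf: "wf {(g, h). less g h}" and B: "infinite B"
    and seg: "\<And>h. h \<in> H \<Longrightarrow> |{g \<in> H. less g h}| \<le>o |B|"
    and anti: "\<And>C. C \<subseteq> H \<Longrightarrow> (\<And>g h. g \<in> C \<Longrightarrow> h \<in> C \<Longrightarrow> \<not> less g h) \<Longrightarrow> |C| \<le>o |E|"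
    and E: "infinite E" "|B| <o |E|"
  shows "|H| \<le>o |E|"
proof -
  let ?s = "cardSuc |B|"
  have Cs: "Card_order ?s" by (simp add: cardSuc_Card_order card_of_Card_order)
  have wo: "wo_rel ?s" using Cs by (simp add: card_order_on_well_order_on wo_rel_def)
  define R where "R = {(g, h). g \<in> H \<and> less g h}"
  have wfR: "wf R" by (rule wf_subset[OF wf]) (auto simp: R_def)
  \<comment> \<open>The rank is the least element of \<open>?s\<close> strictly above the ranks of
    all predecessors in \<open>H\<close>.\<close>
  define F where "F = (\<lambda>(\<rho>::'h \<Rightarrow> _) h. wo_rel.suc ?s (\<rho> ` {g \<in> H. less g h}))"
  define rk where "rk = wfrec R F"
  have rk: "rk h = wo_rel.suc ?s (rk ` {g \<in> H. less g h})" for h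
  proof -
    have "rk h = F (cut rk R h) h" unfolding rk_def by (rule wfrec[OF wfR])
    also have "cut rk R h ` {g \<in> H. less g h} = rk ` {g \<in> H. less g h}"
      by (intro image_cong) (auto simp: cut_def R_def)
    then have "F (cut rk R h) h = wo_rel.suc ?s (rk ` {g \<in> H. less g h})" by (simp add: F_def)
    finally show ?thesis .
  qed
  have field: "h \<in> H \<Longrightarrow> rk h \<in> Field ?s" and nonempty: "h \<in> H \<Longrightarrow> AboveS ?s (rk ` {g \<in> H. less g h}) \<noteq> {}"
    and sub: "h \<in> H \<Longrightarrow> rk ` {g \<in> H. less g h} \<subseteq> Field ?s" for h
  proof (induction h rule: wf_induct_rule[OF wf])
    case (1 h)
    { assume h: "h \<in> H"
      have s: "rk ` {g \<in> H. less g h} \<subseteq> Field ?s" using 1 by auto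
      moreover have "|rk ` {g \<in> H. less g h}| \<le>o |B|"
        using ordLeq_transitive[OF card_of_image seg[OF h]] .
      ultimately have n: "AboveS ?s (rk ` {g \<in> H. less g h}) \<noteq> {}"
        using cardSuc_AboveS_nonempty[OF B] by blast
      have "rk h \<in> Field ?s" unfolding rk[of h] by (rule wo_rel.suc_inField[OF wo s n])
      note s n this }
    then show "h \<in> H \<Longrightarrow> rk h \<in> Field ?s" "h \<in> H \<Longrightarrow> AboveS ?s (rk ` {g \<in> H. less g h}) \<noteq> {}"
      "h \<in> H \<Longrightarrow> rk ` {g \<in> H. less g h} \<subseteq> Field ?s" by blast+
  qed
  have mono: "rk g \<noteq> rk h" if "g \<in> H" "h \<in> H" "less g h" for g h
    using wo_rel.suc_greater[OF wo sub[OF that(2)] nonempty[OF that(2)], of "rk g"] that rk[of h] by auto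
  have "H = (\<Union>a\<in>Field ?s. {h \<in> H. rk h = a})" using field by auto
  moreover have "|\<Union>a\<in>Field ?s. {h \<in> H. rk h = a}| \<le>o |E|"
  proof (rule card_of_UNION_ordLeq_infinite[OF E(1)])
    have "?s \<le>o |E|" using E(2) cardSuc_least[OF card_of_Card_order card_of_Card_order] by blast
    then show "|Field ?s| \<le>o |E|" using ordIso_ordLeq_trans[OF card_of_Field_ordIso[OF Cs]] by blast
    show "\<forall>a\<in>Field ?s. |{h \<in> H. rk h = a}| \<le>o |E|"
      using mono by (intro ballI anti) auto
  qed
  ultimately show ?thesis by simp
qed

section \<open>Functions modulo a \<open>\<sigma>\<close>-ideal\<close>

text \<open>\<open>J\<close> plays the role of the null sets of a measure. Closure under countable
  unions makes the order modulo \<open>J\<close> well-founded and makes some piece of a countable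
  partition of \<open>Y\<close> positive, that is, not in \<open>J\<close>.\<close>

definition sigma_ideal :: "'i set \<Rightarrow> 'i set set \<Rightarrow> bool" where
  "sigma_ideal Y J \<longleftrightarrow> J \<subseteq> Pow Y \<and> {} \<in> J \<and> (\<forall>T\<in>J. \<forall>S. S \<subseteq> T \<longrightarrow> S \<in> J) \<and>
     (\<forall>T :: nat \<Rightarrow> 'i set. range T \<subseteq> J \<longrightarrow> (\<Union>n. T n) \<in> J) \<and> Y \<notin> J"

lemma sigma_ideal_subset: "sigma_ideal Y J \<Longrightarrow> T \<in> J \<Longrightarrow> S \<subseteq> T \<Longrightarrow> S \<in> J"
  unfolding sigma_ideal_def by blast

lemma sigma_ideal_UN: "sigma_ideal Y J \<Longrightarrow> (\<And>n::nat. T n \<in> J) \<Longrightarrow> (\<Union>n. T n) \<in> J"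
  unfolding sigma_ideal_def by blast

lemma sigma_ideal_Un:
  assumes "sigma_ideal Y J" "S \<in> J" "T \<in> J"
  shows "S \<union> T \<in> J"
proof -
  have "(\<Union>n::nat. if n = 0 then S else T) \<in> J"
    using assms by (intro sigma_ideal_UN) auto
  moreover have "S \<union> T \<subseteq> (\<Union>n::nat. if n = 0 then S else T)"
    by (auto split: if_splits)
  ultimately show ?thesis using assms(1) by (blast intro: sigma_ideal_subset)
qed

lemma sigma_ideal_Int_positive:
  assumes "sigma_ideal Y J" "S \<subseteq> Y" "S \<notin> J" "{y \<in> Y. \<not> P y} \<in> J"
  shows "{y \<in> S. P y} \<notin> J"
proof
  assume "{y \<in> S. P y} \<in> J"
  then have "{y \<in> S. P y} \<union> {y \<in> Y. \<not> P y} \<in> J" using assms sigma_ideal_Un by blast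
  moreover have "S \<subseteq> {y \<in> S. P y} \<union> {y \<in> Y. \<not> P y}" using assms(2) by blast
  ultimately show False using assms sigma_ideal_subset by blast
qed

text \<open>Such families stand in for sets of elements of an ultrapower. As \<open>J\<close> need
  not be prime, agreeing only on a set in \<open>J\<close> is more than being distinct modulo
  \<open>J\<close>.\<close>

definition J_different :: "'i set \<Rightarrow> 'i set set \<Rightarrow> ('i \<Rightarrow> 'v) set \<Rightarrow> bool" where
  "J_different Y J H \<longleftrightarrow> (\<forall>g\<in>H. \<forall>h\<in>H. g \<noteq> h \<longrightarrow> {y \<in> Y. g y = h y} \<in> J)"

lemma J_differentD:
  "J_different Y J H \<Longrightarrow> g \<in> H \<Longrightarrow> h \<in> H \<Longrightarrow> g \<noteq> h \<Longrightarrow> {y \<in> Y. g y = h y} \<in> J"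
  unfolding J_different_def by blast

lemma J_different_subset: "J_different Y J H \<Longrightarrow> G \<subseteq> H \<Longrightarrow> J_different Y J G"
  unfolding J_different_def by blast

text \<open>Zorn's lemma gives a maximal \<open>M\<close>; a function in \<open>H\<close> agreeing
  with no member of \<open>M\<close> on a positive set could be added to it.\<close>

lemma maximal_J_different:
  fixes H :: "('i \<Rightarrow> 'v) set"
  assumes "Y \<notin> J"
  shows "\<exists>M\<subseteq>H. J_different Y J M \<and> (\<forall>h\<in>H. \<exists>g\<in>M. {y \<in> Y. g y = h y} \<notin> J)"
proof -
  let ?F = "{M. M \<subseteq> H \<and> J_different Y J M}"
  have "\<exists>M\<in>?F. \<forall>X\<in>?F. M \<subseteq> X \<longrightarrow> X = M"
  proof (rule subset_Zorn')
    fix C assume C: "subset.chain ?F C"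
    then have sub: "\<And>M. M \<in> C \<Longrightarrow> M \<subseteq> H \<and> J_different Y J M"
      and lin: "\<And>M N. M \<in> C \<Longrightarrow> N \<in> C \<Longrightarrow> M \<subseteq> N \<or> N \<subseteq> M"
      by (auto simp: subset_chain_def)
    have "{y \<in> Y. g y = h y} \<in> J" if gh: "g \<in> \<Union>C" "h \<in> \<Union>C" "g \<noteq> h" for g h
    proof -
      obtain M N where MN: "M \<in> C" "g \<in> M" "N \<in> C" "h \<in> N" using gh by auto
      then obtain L where "L \<in> C" "g \<in> L" "h \<in> L" using lin[of M N] by blast
      then show ?thesis using sub[of L] J_differentD[of Y J L g h] gh(3) by blast
    qed
    then show "\<Union>C \<in> ?F" using sub by (auto simp: J_different_def)
  qed
  then obtain M where M: "M \<subseteq> H" "J_different Y J M"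
    and max: "\<And>X. X \<subseteq> H \<Longrightarrow> J_different Y J X \<Longrightarrow> M \<subseteq> X \<Longrightarrow> X = M" by auto
  have "\<exists>g\<in>M. {y \<in> Y. g y = h y} \<notin> J" if h: "h \<in> H" for h
  proof (rule ccontr)
    assume neg: "\<not> ?thesis"
    \<comment> \<open>\<open>h\<close> agrees with itself on all of \<open>Y\<close>, which is
      positive.\<close>
    then have "h \<notin> M" using assms by fastforce
    moreover have "J_different Y J (insert h M)"
      using neg M(2) by (auto simp: J_different_def eq_commute)
    ultimately show False using max[of "insert h M"] h M(1) by blast
  qed
  then show ?thesis using M by blast
qed

section \<open>The order modulo an ideal and its antichains\<close>

definition J_less :: "'i set \<Rightarrow> 'i set set \<Rightarrow> 'v rel \<Rightarrow> ('i \<Rightarrow> 'v) \<Rightarrow> ('i \<Rightarrow> 'v) \<Rightarrow> bool" where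
  "J_less Y J r g h \<longleftrightarrow> {y \<in> Y. g y \<notin> underS r (h y)} \<in> J"

text \<open>Countably many exceptional sets in \<open>J\<close> do not exhaust \<open>Y\<close>, so
  a descending sequence of functions would descend in \<open>r\<close> at a single point.\<close>

lemma wf_J_less:
  assumes J: "sigma_ideal Y J" and r: "Well_order r"
  shows "wf {(g, h). J_less Y J r g h}"
  unfolding wf_iff_no_infinite_down_chain
proof (rule notI, elim exE)
  fix f assume f: "\<forall>i. (f (Suc i), f i) \<in> {(g, h). J_less Y J r g h}"
  then have "(\<Union>i. {y \<in> Y. f (Suc i) y \<notin> underS r (f i y)}) \<in> J"
    by (intro sigma_ideal_UN[OF J]) (simp add: J_less_def)
  then have "(\<Union>i. {y \<in> Y. f (Suc i) y \<notin> underS r (f i y)}) \<noteq> Y"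
    using J by (auto simp: sigma_ideal_def)
  then obtain y where y: "y \<in> Y" "\<And>i. f (Suc i) y \<in> underS r (f i y)" by blast
  have "\<not> (\<forall>i. (g (Suc i), g i) \<in> r - Id)" for g
    using r unfolding well_order_on_def wf_iff_no_infinite_down_chain by blast
  from this[of "\<lambda>i. f i y"] show False using y(2) by (auto simp: underS_def)
qed

text \<open>
  Take \<open>M \<subseteq> H\<close> of size at most \<open>2\<^bsup>|Y|\<^esup>\<close> that contains, for all upper bounds given at the points of a
  subset of \<open>Y\<close> by members of \<open>M\<close>, a function obeying them whenever \<open>H\<close> does. If \<open>h \<in> H - M\<close>, let the
  bound at \<open>y\<close> be the least value in \<open>{g y | g \<in> M}\<close> above \<open>h y\<close>. A function in \<open>M\<close> obeying these bounds
  is nowhere above \<open>h\<close>, hence less than \<open>h\<close> modulo \<open>J\<close>.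
\<close>

lemma J_antichain_card:
  fixes H :: "('i \<Rightarrow> 'v) set"
  assumes J: "sigma_ideal Y J" and r: "Well_order r" and Y: "infinite Y"
    and H: "J_different Y J H" "\<And>h. h \<in> H \<Longrightarrow> h ` Y \<subseteq> Field r"
    and anti: "\<And>g h. g \<in> H \<Longrightarrow> h \<in> H \<Longrightarrow> \<not> J_less Y J r g h"
  shows "|H| \<le>o |Pow Y|"
proof (cases "H = {}")
  case True
  then show ?thesis by (simp add: card_of_empty)
next
  case False
  then obtain a0 where a0: "a0 \<in> H" by blast
  have wor: "wo_rel r" using r by (simp add: wo_rel_def)
  \<comment> \<open>The closure runs through \<open>|Y|^+\<close> stages, so that by regularity any
    \<open>|Y|\<close> members of \<open>M\<close> occur together at one stage.\<close>
  let ?s = "cardSuc |Y|"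
  have Cs: "Card_order ?s" by (simp add: cardSuc_Card_order card_of_Card_order)
  have wos: "wo_rel ?s" using Cs by (simp add: card_order_on_well_order_on wo_rel_def)
  define below where "below D k h \<longleftrightarrow> h \<in> H \<and> (\<forall>y\<in>D. h y \<in> underS r (k y y))"
    for D :: "'i set" and k :: "'i \<Rightarrow> 'i \<Rightarrow> 'v" and h
  \<comment> \<open>\<open>k\<close> assigns a function to each point, and only the diagonal values
    \<open>k y y\<close> serve as bounds. Inserting \<open>a0\<close> starts the construction, as
    \<open>Func Y {}\<close> is empty.\<close>
  define \<Phi> where "\<Phi> X = (\<lambda>(D, k). SOME h. below D k h) `
     {(D, k). D \<subseteq> Y \<and> k \<in> Func Y (insert a0 X) \<and> (\<exists>h. below D k h)}" for X
  have \<Phi>_H: "\<Phi> X \<subseteq> H" for X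
  proof
    fix h assume "h \<in> \<Phi> X"
    then obtain D k where "h = (SOME h. below D k h)" "\<exists>h. below D k h" by (auto simp: \<Phi>_def)
    then have "below D k h" by (metis someI_ex)
    then show "h \<in> H" by (simp add: below_def)
  qed
  have PowY: "infinite (Pow Y)" using Y by simp
  have \<Phi>_card: "|\<Phi> X| \<le>o |Pow Y|" if "|X| \<le>o |Pow Y|" for X
  proof -
    have "|insert a0 X| \<le>o |Pow Y|"
      using card_of_insert_le[OF PowY that] .
    then have "|Pow Y \<times> Func Y (insert a0 X)| \<le>o |Pow Y|"
      by (intro card_of_Times_le[OF PowY] card_of_Func_le_Pow[OF Y])
        (simp_all add: ordLeq_refl card_of_card_order_on Field_card_of)
    moreover have "\<Phi> X \<subseteq> (\<lambda>(D, k). SOME h. below D k h) ` (Pow Y \<times> Func Y (insert a0 X))"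
      unfolding \<Phi>_def by (intro image_mono) auto
    ultimately show ?thesis
      using ordLeq_transitive[OF card_of_mono1 ordLeq_transitive[OF card_of_image]] by blast
  qed
  define N where "N = wfrec (?s - Id) (\<lambda>N i. \<Union>j\<in>underS ?s i. \<Phi> (N j))"
  have N: "N i = (\<Union>j\<in>underS ?s i. \<Phi> (N j))" for i
  proof -
    have "N i = (\<Union>j\<in>underS ?s i. \<Phi> (cut N (?s - Id) i j))"
      unfolding N_def by (rule wfrec[OF wo_rel.WF[OF wos]])
    also have "\<dots> = (\<Union>j\<in>underS ?s i. \<Phi> (N j))"
      by (intro SUP_cong) (auto simp: cut_def underS_def)
    finally show ?thesis .
  qed
  have s_le: "|Field ?s| \<le>o |Pow Y|"
    using ordIso_ordLeq_trans[OF card_of_Field_ordIso[OF Cs]]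
      cardSuc_least[OF card_of_Card_order card_of_Card_order card_of_Pow] by blast
  have N_card: "|N i| \<le>o |Pow Y|" for i
  proof (induction i rule: wf_induct_rule[OF wo_rel.WF[OF wos]])
    case (1 i)
    have "|underS ?s i| \<le>o |Field ?s|" by (rule card_of_mono1) (auto simp: underS_def Field_def)
    then have "|underS ?s i| \<le>o |Pow Y|" using s_le ordLeq_transitive by blast
    moreover have "\<forall>j\<in>underS ?s i. |\<Phi> (N j)| \<le>o |Pow Y|"
      using 1 \<Phi>_card by (auto simp: underS_def)
    ultimately show ?case unfolding N[of i] by (rule card_of_UNION_ordLeq_infinite[OF PowY])
  qed
  define M where "M = insert a0 (\<Union>i\<in>Field ?s. N i)"
  have "|\<Union>i\<in>Field ?s. N i| \<le>o |Pow Y|"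
    by (rule card_of_UNION_ordLeq_infinite[OF PowY s_le]) (simp add: N_card)
  then have M_card: "|M| \<le>o |Pow Y|"
    unfolding M_def by (rule card_of_insert_le[OF PowY])
  have M_H: "M \<subseteq> H" using a0 \<Phi>_H N unfolding M_def by blast
  have closed: "\<exists>h\<in>M. below D k h" if D: "D \<subseteq> Y" and k: "k ` Y \<subseteq> M" and ex: "\<exists>h. below D k h" for D k
  proof -
    have mono: "N i \<subseteq> N j" if "(i, j) \<in> ?s" for i j
      using that unfolding N[of i] N[of j]
      by (intro UN_mono underS_incr wo_rel.TRANS[OF wos] wo_rel.ANTISYM[OF wos]) auto
    have inf: "infinite (Field ?s)"
      using Y by (simp add: cardSuc_finite[OF card_of_Card_order] Field_card_of)
    have "|k ` Y| \<le>o |Y|" by (rule card_of_image)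
    moreover have "relChain ?s (\<lambda>i. insert a0 (N i))" using mono by (auto simp: relChain_def)
    moreover have "k ` Y \<subseteq> (\<Union>i\<in>Field ?s. insert a0 (N i))"
      using k inf by (auto simp: M_def)
    ultimately obtain i where i: "i \<in> Field ?s" "k ` Y \<subseteq> insert a0 (N i)"
      using cardSuc_UNION[OF card_of_Card_order, of Y "\<lambda>i. insert a0 (N i)" "k ` Y"] Y
      by (auto simp: Field_card_of)
    obtain j where j: "j \<in> Field ?s" "i \<in> underS ?s j"
      using infinite_Card_order_limit[OF Cs inf i(1)] by (auto simp: underS_def)
    define k' where "k' y = (if y \<in> Y then k y else undefined)" for y
    have "k' \<in> Func Y (insert a0 (N i))" using i(2) by (auto simp: Func_def k'_def)
    moreover have eq: "below D k' = below D k" using D by (auto simp: below_def k'_def fun_eq_iff)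
    ultimately have "(SOME h. below D k' h) \<in> \<Phi> (N i)"
      using D ex unfolding \<Phi>_def by (intro image_eqI[of _ _ "(D, k')"]) auto
    then have "(SOME h. below D k' h) \<in> M" using j N[of j] by (auto simp: M_def)
    moreover have "below D k (SOME h. below D k' h)" using ex eq by (metis someI_ex)
    ultimately show ?thesis by blast
  qed
  have "H \<subseteq> M"
  proof
    fix h assume h: "h \<in> H"
    show "h \<in> M"
    proof (rule ccontr)
      assume hM: "h \<notin> M"
      define D where "D = {y \<in> Y. \<exists>g\<in>M. h y \<in> underS r (g y)}"
      have "\<exists>g. (y \<in> Y \<longrightarrow> g \<in> M) \<and> (y \<in> D \<longrightarrow> h y \<in> underS r (g y) \<and>
          (\<forall>g'\<in>M. h y \<in> underS r (g' y) \<longrightarrow> (g y, g' y) \<in> r))" for y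
      proof (cases "y \<in> D")
        case True
        let ?V = "{g y |g. g \<in> M \<and> h y \<in> underS r (g y)}"
        have V: "?V \<subseteq> Field r" "?V \<noteq> {}"
          using True by (auto simp: D_def underS_def Field_def)
        obtain g where "wo_rel.minim r ?V = g y" "g \<in> M" "h y \<in> underS r (g y)"
          using wo_rel.minim_in[OF wor V] by auto
        moreover have "\<forall>g'\<in>M. h y \<in> underS r (g' y) \<longrightarrow> (g y, g' y) \<in> r"
          using wo_rel.minim_least[OF wor V(1)] \<open>wo_rel.minim r ?V = g y\<close> by auto
        ultimately show ?thesis by blast
      next
        case False
        then show ?thesis by (auto simp: M_def)
      qed
      then obtain k where k: "\<And>y. y \<in> Y \<Longrightarrow> k y \<in> M"
        "\<And>y. y \<in> D \<Longrightarrow> h y \<in> underS r (k y y)"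
        "\<And>y g. y \<in> D \<Longrightarrow> g \<in> M \<Longrightarrow> h y \<in> underS r (g y) \<Longrightarrow> (k y y, g y) \<in> r"
        by metis
      have "below D k h" using h k(2) by (auto simp: below_def)
      then obtain g where g: "g \<in> M" "below D k g"
        using closed[of D k] k(1) by (auto simp: D_def)
      have "h y \<notin> underS r (g y)" if "y \<in> Y" for y
      proof
        assume "h y \<in> underS r (g y)"
        then have "y \<in> D" using that g(1) by (auto simp: D_def)
        then have "(k y y, g y) \<in> r" "g y \<in> underS r (k y y)"
          using k(3) g \<open>h y \<in> underS r (g y)\<close> by (auto simp: below_def)
        then show False using wo_rel.ANTISYM[OF wor] by (auto simp: underS_def antisym_def)
      qed
      moreover have "g y \<in> Field r" "h y \<in> Field r" if "y \<in> Y" for y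
        using that h g(1) M_H H(2) by blast+
      ultimately have "(g y, h y) \<in> r" if "y \<in> Y" for y
        using that wo_rel.TOTALS[OF wor] wo_rel.REFL[OF wor]
        by (force simp: underS_def refl_on_def)
      then have "{y \<in> Y. g y \<notin> underS r (h y)} \<subseteq> {y \<in> Y. g y = h y}"
        by (auto simp: underS_def)
      moreover have "{y \<in> Y. g y = h y} \<in> J"
        using g(1) h hM M_H by (intro J_differentD[OF H(1)]) auto
      ultimately have "J_less Y J r g h"
        unfolding J_less_def using sigma_ideal_subset[OF J] by blast
      then show False using anti g(1) h M_H by blast
    qed
  qed
  from ordLeq_transitive[OF card_of_mono1[OF this] M_card] show ?thesis .
qed

section \<open>A minimal function with as many as \<open>|A|\<close> functions below it\<close>

lemma card_not_ordLeq_iff: "\<not> |A| \<le>o |B| \<longleftrightarrow> |B| <o |A|"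
  by (rule not_ordLeq_iff_ordLess[OF card_of_Well_order card_of_Well_order])

lemma card_of_Times_ordLess:
  assumes "infinite A" "|M| <o |A|" "|N| <o |A|" "infinite N"
  shows "|M \<times> N| <o |A|"
proof -
  have "|M <+> N| <o |A|" by (rule card_of_Plus_ordLess_infinite[OF assms(1-3)])
  moreover have "|M \<times> N| \<le>o |M <+> N|"
    using assms(4) by (intro card_of_Times_le card_of_Plus1 card_of_Plus2) (simp add: finite_Plus_iff)
  ultimately show ?thesis using ordLeq_ordLess_trans by blast
qed

lemma ordLess_card_of_ordLeq_underS:
  assumes "|X| <o |A|"
  obtains a where "a \<in> A" "|X| \<le>o |underS |A| a|"
proof -
  obtain a where a: "a \<in> A" "|X| =o Restr |A| (underS |A| a)"
    using assms ordLess_iff_ordIso_Restr[OF card_of_Well_order[of A] card_of_Well_order[of X]]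
    unfolding Field_card_of by blast
  have "|X| =o |Field (Restr |A| (underS |A| a))|"
    using card_of_cong[OF a(2)] by (simp add: Field_card_of)
  also have "|Field (Restr |A| (underS |A| a))| \<le>o |underS |A| a|"
    by (rule card_of_mono1) (auto simp: Field_def)
  finally show thesis using that a(1) by blast
qed

text \<open>
  The cardinals less than \<open>r\<close> are represented by its initial segments, so the bound is uniform in \<open>H\<close>
  and less than \<open>r\<close>.
\<close>

definition J_small :: "'i set \<Rightarrow> 'i set set \<Rightarrow> 'v rel \<Rightarrow> ('i \<Rightarrow> 'v) \<Rightarrow> bool" where
  "J_small Y J r f \<longleftrightarrow> (\<exists>a\<in>Field r. \<forall>H. J_different Y J H \<longrightarrow>
     (\<forall>h\<in>H. h ` Y \<subseteq> Field r \<and> J_less Y J r h f) \<longrightarrow> |H| \<le>o |underS r a| )"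

text \<open>Group the members of \<open>H\<close> by the initial segment of \<open>|A|\<close> that
  witnesses \<open>J_small\<close>. Within a group the number of predecessors is bounded below
  \<open>|A|\<close> and antichains have size at most \<open>2^|Y|\<close>, so the ranking argument
  bounds the group by \<open>|A|\<close>; there are at most \<open>|A|\<close> groups.\<close>

lemma card_le_if_all_J_small:
  fixes Y A :: "'a set"
  assumes J: "sigma_ideal Y J" and Y: "infinite Y" "|Pow Y| \<le>o |A|"
    and H: "J_different Y J H" "\<And>h. h \<in> H \<Longrightarrow> h ` Y \<subseteq> A" "\<And>h. h \<in> H \<Longrightarrow> J_small Y J |A| h"
  shows "|H| \<le>o |A|"
proof -
  have YA: "|Y| <o |A|" using ordLess_ordLeq_trans[OF card_of_Pow Y(2)] .
  have A: "infinite A" using Y card_of_ordLeq_finite[OF Y(2)] by auto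
  have "\<forall>h. \<exists>a. h \<in> H \<longrightarrow> a \<in> A \<and> (\<forall>G. J_different Y J G \<longrightarrow>
     (\<forall>g\<in>G. g ` Y \<subseteq> A \<and> J_less Y J |A| g h) \<longrightarrow> |G| \<le>o |underS |A| a| )"
    using H(3) unfolding J_small_def Field_card_of by blast
  then obtain \<theta> where \<theta>: "\<And>h. h \<in> H \<Longrightarrow> \<theta> h \<in> A"
    "\<And>h G. h \<in> H \<Longrightarrow> J_different Y J G \<Longrightarrow>
       (\<And>g. g \<in> G \<Longrightarrow> g ` Y \<subseteq> A \<and> J_less Y J |A| g h) \<Longrightarrow> |G| \<le>o |underS |A| (\<theta> h)|"
    by metis
  have "|{h \<in> H. \<theta> h = a}| \<le>o |A|" if a: "a \<in> A" for a
  proof (rule card_le_if_small_segments_and_antichains[OF wf_J_less[OF J card_of_Well_order[of A]]])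
    \<comment> \<open>Adding \<open>Y\<close> makes the bound infinite while keeping it below
      \<open>|A|\<close>.\<close>
    let ?B = "underS |A| a \<union> Y"
    show "infinite ?B" using Y(1) by simp
    have "|underS |A| a| <o |A|" using card_of_underS[OF card_of_Card_order] a by (simp add: Field_card_of)
    then show "|?B| <o |A|" by (rule card_of_Un_ordLess_infinite[OF A _ YA])
    show "infinite A" by (rule A)
    show "|{g \<in> {h \<in> H. \<theta> h = a}. J_less Y J |A| g h}| \<le>o |?B|" if "h \<in> {h \<in> H. \<theta> h = a}" for h
    proof -
      have "|{g \<in> {h \<in> H. \<theta> h = a}. J_less Y J |A| g h}| \<le>o |underS |A| (\<theta> h)|"
        using that H(2) by (intro \<theta>(2) J_different_subset[OF H(1)]) auto
      then show ?thesis using that ordLeq_transitive[OF _ card_of_mono1[of "underS |A| a" ?B]] by auto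
    qed
    show "|C| \<le>o |A|" if C: "C \<subseteq> {h \<in> H. \<theta> h = a}"
      "\<And>g h. g \<in> C \<Longrightarrow> h \<in> C \<Longrightarrow> \<not> J_less Y J |A| g h" for C
    proof (rule ordLeq_transitive[OF J_antichain_card[OF J card_of_Well_order Y(1) _ _ C(2)] Y(2)])
      show "J_different Y J C" using C(1) by (intro J_different_subset[OF H(1)]) auto
      show "h ` Y \<subseteq> Field |A|" if "h \<in> C" for h using that C(1) H(2)[of h] by (auto simp: Field_card_of)
    qed
  qed
  then have "|\<Union>a\<in>A. {h \<in> H. \<theta> h = a}| \<le>o |A|"
    by (intro card_of_UNION_ordLeq_infinite[OF A] ballI) (simp_all add: ordLeq_refl card_of_card_order_on Field_card_of)
  moreover have "H = (\<Union>a\<in>A. {h \<in> H. \<theta> h = a})" using \<theta>(1) by auto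
  ultimately show ?thesis by simp
qed

text \<open>A family of more than \<open>|A|\<close> functions contains one that is not
  \<open>J_small\<close>. Below a minimal function of this kind every function is
  \<open>J_small\<close>, which bounds the families there.\<close>

lemma exists_minimal_not_J_small:
  fixes Y A :: "'a set"
  assumes J: "sigma_ideal Y J" and Y: "infinite Y" "|Pow Y| \<le>o |A|"
    and H: "J_different Y J H" "\<And>h. h \<in> H \<Longrightarrow> h ` Y \<subseteq> A" "\<not> |H| \<le>o |A|"
  obtains f where "f ` Y \<subseteq> A" "\<not> J_small Y J |A| f"
    "\<And>G. J_different Y J G \<Longrightarrow> (\<And>g. g \<in> G \<Longrightarrow> g ` Y \<subseteq> A \<and> J_less Y J |A| g f) \<Longrightarrow> |G| \<le>o |A|"
proof -
  let ?B = "{f. f ` Y \<subseteq> A \<and> \<not> J_small Y J |A| f}"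
  obtain f0 where "f0 \<in> ?B" using card_le_if_all_J_small[OF J Y H(1,2)] H(2,3) by blast
  then obtain f where f: "f \<in> ?B" "\<And>g. (g, f) \<in> {(g, h). J_less Y J |A| g h} \<Longrightarrow> g \<notin> ?B"
    using wfE_min[OF wf_J_less[OF J card_of_Well_order[of A]], of f0 ?B] by blast
  show thesis
  proof (rule that)
    show "|G| \<le>o |A|" if "J_different Y J G" "\<And>g. g \<in> G \<Longrightarrow> g ` Y \<subseteq> A \<and> J_less Y J |A| g f" for G
      using f(2) that by (intro card_le_if_all_J_small[OF J Y that(1)]) auto
  qed (use f(1) in auto)
qed

text \<open>A maximal family \<open>M\<close> below \<open>f\<close> has at least \<open>|A|\<close>
  members: otherwise every family below \<open>f\<close> would inject into
  \<open>M \<times> Pow Y\<close>, whose size is less than \<open>|A|\<close>, and \<open>f\<close>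
  would be \<open>J_small\<close>.\<close>

lemma not_J_small_family:
  fixes Y A :: "'a set"
  assumes J: "sigma_ideal Y J" and Y: "infinite Y" "|Pow Y| <o |A|"
    and f: "\<not> J_small Y J |A| f"
  obtains \<phi> where "\<And>\<xi>. \<xi> \<in> A \<Longrightarrow> \<phi> \<xi> ` Y \<subseteq> A \<and> J_less Y J |A| (\<phi> \<xi>) f"
    "\<And>\<xi> \<zeta>. \<xi> \<in> A \<Longrightarrow> \<zeta> \<in> A \<Longrightarrow> \<xi> \<noteq> \<zeta> \<Longrightarrow> {y \<in> Y. \<phi> \<xi> y = \<phi> \<zeta> y} \<in> J"
proof -
  have A: "infinite A" using Y card_of_ordLeq_finite[OF ordLess_imp_ordLeq[OF Y(2)]] by auto
  have YJ: "Y \<notin> J" using J by (simp add: sigma_ideal_def)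
  obtain M where M: "M \<subseteq> {h. h ` Y \<subseteq> A \<and> J_less Y J |A| h f}" "J_different Y J M"
    "\<And>h. h \<in> {h. h ` Y \<subseteq> A \<and> J_less Y J |A| h f} \<Longrightarrow> \<exists>g\<in>M. {y \<in> Y. g y = h y} \<notin> J"
    using maximal_J_different[OF YJ, of "{h. h ` Y \<subseteq> A \<and> J_less Y J |A| h f}"] by blast
  have "|A| \<le>o |M|"
  proof (rule ccontr)
    assume "\<not> |A| \<le>o |M|"
    then have "|M| <o |A|" by (simp add: card_not_ordLeq_iff)
    then have "|M \<times> Pow Y| <o |A|" using Y by (intro card_of_Times_ordLess[OF A]) auto
    then obtain a where a: "a \<in> A" "|M \<times> Pow Y| \<le>o |underS |A| a|"
      by (rule ordLess_card_of_ordLeq_underS)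
    have "|H| \<le>o |underS |A| a|"
      if H: "J_different Y J H" "\<forall>h\<in>H. h ` Y \<subseteq> Field |A| \<and> J_less Y J |A| h f" for H
    proof -
      have "\<forall>h\<in>H. \<exists>g. g \<in> M \<and> {y \<in> Y. g y = h y} \<notin> J"
        using M(3) H(2) unfolding Field_card_of by blast
      then obtain \<gamma> where \<gamma>: "\<And>h. h \<in> H \<Longrightarrow> \<gamma> h \<in> M" "\<And>h. h \<in> H \<Longrightarrow> {y \<in> Y. \<gamma> h y = h y} \<notin> J"
        by metis
      \<comment> \<open>The code of \<open>h\<close> is a member of \<open>M\<close> agreeing with
        it on a positive set, together with that set. Two functions with the same code agree on this
        positive set, so they are equal.\<close>
      have "inj_on (\<lambda>h. (\<gamma> h, {y \<in> Y. \<gamma> h y = h y})) H"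
      proof (rule inj_onI, rule ccontr)
        fix g h assume gh: "g \<in> H" "h \<in> H" "g \<noteq> h"
          "(\<gamma> g, {y \<in> Y. \<gamma> g y = g y}) = (\<gamma> h, {y \<in> Y. \<gamma> h y = h y})"
        have "{y \<in> Y. \<gamma> g y = g y} \<subseteq> {y \<in> Y. g y = h y}"
        proof
          fix y assume y: "y \<in> {y \<in> Y. \<gamma> g y = g y}"
          have eq: "\<gamma> g = \<gamma> h" "{y \<in> Y. \<gamma> g y = g y} = {y \<in> Y. \<gamma> h y = h y}"
            using gh(4) unfolding prod.inject by blast+
          have "y \<in> {y \<in> Y. \<gamma> h y = h y}" using y unfolding eq(2) .
          then show "y \<in> {y \<in> Y. g y = h y}" using y eq(1) by simp
        qed
        then show False
          using J_differentD[OF H(1) gh(1-3)] sigma_ideal_subset[OF J] \<gamma>(2)[OF gh(1)] by blast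
      qed
      then have "|H| \<le>o |M \<times> Pow Y|" by (rule card_of_ordLeqI) (use \<gamma>(1) in auto)
      then show ?thesis using a(2) ordLeq_transitive by blast
    qed
    then have "J_small Y J |A| f" using a(1) unfolding J_small_def by (auto simp: Field_card_of)
    then show False using f by simp
  qed
  then obtain \<phi> where \<phi>: "inj_on \<phi> A" "\<phi> ` A \<subseteq> M"
    using card_of_ordLeq[of A M] by auto
  show thesis
  proof (rule that)
    show "\<phi> \<xi> ` Y \<subseteq> A \<and> J_less Y J |A| (\<phi> \<xi>) f" if "\<xi> \<in> A" for \<xi> using that \<phi>(2) M(1) by auto
    show "{y \<in> Y. \<phi> \<xi> y = \<phi> \<zeta> y} \<in> J" if "\<xi> \<in> A" "\<zeta> \<in> A" "\<xi> \<noteq> \<zeta>" for \<xi> \<zeta>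
      using that \<phi> by (intro J_differentD[OF M(2)]) (auto dest: inj_onD)
  qed
qed

lemma sigma_ideal_Int_Pow:
  assumes "sigma_ideal Y J" "S \<subseteq> Y" "S \<notin> J"
  shows "sigma_ideal S (J \<inter> Pow S)"
  unfolding sigma_ideal_def
proof (intro conjI allI impI ballI)
  show "(\<Union>n. T n) \<in> J \<inter> Pow S" if "range T \<subseteq> J \<inter> Pow S" for T :: "nat \<Rightarrow> _"
    using that sigma_ideal_UN[OF assms(1), of T] by auto
  show "\<And>T U. T \<in> J \<inter> Pow S \<Longrightarrow> U \<subseteq> T \<Longrightarrow> U \<in> J \<inter> Pow S"
    using sigma_ideal_subset[OF assms(1)] by blast
  show "{} \<in> J \<inter> Pow S" using assms(1) by (auto simp: sigma_ideal_def)
qed (use assms(3) in auto)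

text \<open>
  Families witnessing the failure of the bound on each of countably many pieces could be glued to
  one on all of \<open>Y\<close>.
\<close>

lemma bounded_on_positive_fibre:
  fixes Y A :: "'a set" and n :: "'a \<Rightarrow> nat"
  assumes J: "sigma_ideal Y J" and A: "A \<noteq> {}"
    and f: "\<And>G. J_different Y J G \<Longrightarrow> (\<And>g. g \<in> G \<Longrightarrow> g ` Y \<subseteq> A \<and> J_less Y J |A| g f) \<Longrightarrow> |G| \<le>o |A|"
  obtains k where "{y \<in> Y. n y = k} \<notin> J"
    "\<And>G. J_different {y \<in> Y. n y = k} (J \<inter> Pow {y \<in> Y. n y = k}) G \<Longrightarrow>
       (\<And>g. g \<in> G \<Longrightarrow> g ` {y \<in> Y. n y = k} \<subseteq> A \<and>
          J_less {y \<in> Y. n y = k} (J \<inter> Pow {y \<in> Y. n y = k}) |A| g f) \<Longrightarrow> |G| \<le>o |A|"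
proof (rule ccontr)
  note fibre = that
  assume neg: "\<not> thesis"
  let ?S = "\<lambda>k. {y \<in> Y. n y = k}"
  \<comment> \<open>A failure on any fibre provides a family indexed by \<open>|A|^+\<close>. The
    common index set allows the families to be glued.\<close>
  let ?I = "Field (cardSuc |A| )"
  let ?r = "|A|"
  define good where "good k \<psi> \<longleftrightarrow> (\<forall>i\<in>?I. \<psi> i ` ?S k \<subseteq> A \<and> J_less (?S k) (J \<inter> Pow (?S k)) ?r (\<psi> i) f) \<and>
      (\<forall>i\<in>?I. \<forall>j\<in>?I. i \<noteq> j \<longrightarrow> {y \<in> ?S k. \<psi> i y = \<psi> j y} \<in> J)" for k \<psi>
  have "\<exists>\<psi>. ?S k \<notin> J \<longrightarrow> good k \<psi>" for k
  proof (cases "?S k \<in> J")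
    case False
    then obtain G where G: "J_different (?S k) (J \<inter> Pow (?S k)) G"
      "\<And>g. g \<in> G \<Longrightarrow> g ` ?S k \<subseteq> A \<and> J_less (?S k) (J \<inter> Pow (?S k)) |A| g f" "\<not> |G| \<le>o |A|"
      using fibre[of k] neg by blast
    have "cardSuc |A| \<le>o |G|"
      using G(3) by (intro cardSuc_least card_of_Card_order) (simp add: card_not_ordLeq_iff)
    then have "|?I| \<le>o |G|"
      by (rule ordIso_ordLeq_trans[OF card_of_Field_ordIso[OF cardSuc_Card_order[OF card_of_Card_order]]])
    then obtain \<psi> where \<psi>: "inj_on \<psi> ?I" "\<psi> ` ?I \<subseteq> G" using card_of_ordLeq[of ?I G] by auto
    have "{y \<in> ?S k. \<psi> i y = \<psi> j y} \<in> J" if "i \<in> ?I" "j \<in> ?I" "i \<noteq> j" for i j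
    proof -
      have "\<psi> i \<in> G" "\<psi> j \<in> G" "\<psi> i \<noteq> \<psi> j" using that \<psi> by (auto dest: inj_onD)
      from J_differentD[OF G(1) this] show ?thesis by simp
    qed
    moreover have "\<forall>i\<in>?I. \<psi> i ` ?S k \<subseteq> A \<and> J_less (?S k) (J \<inter> Pow (?S k)) |A| (\<psi> i) f"
      using G(2) \<psi>(2) by blast
    ultimately show ?thesis by (auto simp: good_def)
  qed blast
  then obtain \<psi> where "\<And>k. ?S k \<notin> J \<Longrightarrow> good k (\<psi> k)" by metis
  then have \<psi>:
    "\<And>k i. ?S k \<notin> J \<Longrightarrow> i \<in> ?I \<Longrightarrow> \<psi> k i ` ?S k \<subseteq> A"
    "\<And>k i. ?S k \<notin> J \<Longrightarrow> i \<in> ?I \<Longrightarrow> J_less (?S k) (J \<inter> Pow (?S k)) |A| (\<psi> k i) f"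
    "\<And>k i j. ?S k \<notin> J \<Longrightarrow> i \<in> ?I \<Longrightarrow> j \<in> ?I \<Longrightarrow> i \<noteq> j \<Longrightarrow> {y \<in> ?S k. \<psi> k i y = \<psi> k j y} \<in> J"
    unfolding good_def by blast+
  obtain a where a: "a \<in> A" using A by blast
  \<comment> \<open>On fibres in \<open>J\<close> the constant \<open>a\<close> does no harm, as the
    union of these countably many fibres is in \<open>J\<close>.\<close>
  define g where "g i y = (if ?S (n y) \<in> J then a else \<psi> (n y) i y)" for i y
  have glue: "{y \<in> Y. Q y} \<in> J" if "\<And>k. ?S k \<notin> J \<Longrightarrow> {y \<in> ?S k. Q y} \<in> J" for Q
  proof -
    have "{y \<in> ?S k. Q y} \<in> J" for k
      using that[of k] sigma_ideal_subset[OF J, of "?S k" "{y \<in> ?S k. Q y}"] by blast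
    then have "(\<Union>k. {y \<in> ?S k. Q y}) \<in> J" by (rule sigma_ideal_UN[OF J])
    moreover have "(\<Union>k. {y \<in> ?S k. Q y}) = {y \<in> Y. Q y}" by auto
    ultimately show ?thesis by simp
  qed
  have diff: "{y \<in> Y. g i y = g j y} \<in> J" if ij: "i \<in> ?I" "j \<in> ?I" "i \<noteq> j" for i j
  proof (rule glue)
    fix k assume k: "?S k \<notin> J"
    then have "{y \<in> ?S k. g i y = g j y} = {y \<in> ?S k. \<psi> k i y = \<psi> k j y}"
      by (auto simp: g_def)
    then show "{y \<in> ?S k. g i y = g j y} \<in> J" using \<psi>(3)[OF k ij] by simp
  qed
  have "|g ` ?I| \<le>o |A|"
  proof (rule f)
    show "J_different Y J (g ` ?I)" using diff unfolding J_different_def by blast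
    fix h assume "h \<in> g ` ?I"
    then obtain i where i: "i \<in> ?I" "h = g i" by blast
    have "{y \<in> Y. g i y \<notin> underS |A| (f y)} \<in> J"
    proof (rule glue)
      fix k assume k: "?S k \<notin> J"
      then have "{y \<in> ?S k. g i y \<notin> underS |A| (f y)} = {y \<in> ?S k. \<psi> k i y \<notin> underS |A| (f y)}"
        by (auto simp: g_def)
      then show "{y \<in> ?S k. g i y \<notin> underS |A| (f y)} \<in> J"
        using \<psi>(2)[OF k i(1)] by (simp add: J_less_def)
    qed
    moreover have "g i ` Y \<subseteq> A" using \<psi>(1)[OF _ i(1)] a by (force simp: g_def)
    ultimately show "h ` Y \<subseteq> A \<and> J_less Y J |A| h f" by (simp add: i(2) J_less_def)
  qed
  moreover have "inj_on g ?I"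
  proof (rule inj_onI, rule ccontr)
    fix i j assume "i \<in> ?I" "j \<in> ?I" "g i = g j" "i \<noteq> j"
    then have "Y \<in> J" using diff[of i j] by simp
    then show False using J by (simp add: sigma_ideal_def)
  qed
  ultimately have "|?I| \<le>o |A|" using card_of_ordLeqI[of g ?I "g ` ?I"] ordLeq_transitive by blast
  then have "cardSuc |A| \<le>o |A|"
    using ordIso_ordLeq_trans[OF ordIso_symmetric[OF card_of_Field_ordIso[OF cardSuc_Card_order[OF card_of_Card_order]]]] by blast
  then show False
    using cardSuc_greater[OF card_of_Card_order[of A]] not_ordLess_ordLeq by blast
qed

lemma ex_subset_of_card:
  assumes "r \<le>o |A|" "Card_order r"
  shows "\<exists>Z\<subseteq>A. |Z| =o r"
proof -
  have "|Field r| \<le>o |A|"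
    by (rule ordIso_ordLeq_trans[OF card_of_Field_ordIso[OF assms(2)] assms(1)])
  then obtain f where f: "inj_on f (Field r)" "f ` Field r \<subseteq> A"
    using card_of_ordLeq[of "Field r" A] by auto
  have "|f ` Field r| =o |Field r|"
    by (rule ordIso_symmetric[OF card_of_ordIsoI[OF inj_on_imp_bij_betw[OF f(1)]]])
  from ordIso_transitive[OF this card_of_Field_ordIso[OF assms(2)]]
  show ?thesis using f(2) by auto
qed

section \<open>Coverings of small subsets\<close>

locale beth_sequence =
  fixes b :: "nat \<Rightarrow> 'm rel"
  assumes Cinfinite_0: "Cinfinite (b 0)"
    and Card_order_b: "Card_order (b n)"
    and Suc_b: "b (Suc n) =o ctwo ^c b n"
begin

lemma b_ordLess_Suc: "b n <o b (Suc n)"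
  using ordLess_ordIso_trans[OF ordLess_ctwo_cexp[OF Card_order_b] ordIso_symmetric[OF Suc_b]] .

lemma b_mono: "m \<le> n \<Longrightarrow> b m \<le>o b n"
proof (induction n rule: nat_induct_at_least[of m])
  case base
  then show ?case by (simp add: ordLeq_refl Card_order_b)
next
  case (Suc n)
  then show ?case using ordLess_imp_ordLeq[OF b_ordLess_Suc] ordLeq_transitive by blast
qed

lemma Cinfinite_b: "Cinfinite (b n)"
  using cinfinite_mono[OF b_mono[of 0 n]] Cinfinite_0 Card_order_b by blast

lemma nat_ordLeq_b: "|I :: nat set| \<le>o b n"
proof -
  have "|I| \<le>o natLeq"
    using ordLeq_ordIso_trans[OF card_of_mono1[of I UNIV] card_of_nat] by simp
  then show ?thesis using natLeq_ordLeq_cinfinite[OF Cinfinite_b] ordLeq_transitive by blast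
qed

lemma singl_ordLeq_b: "|{x}| \<le>o b n"
  using Card_order_singl_ordLeq[OF Card_order_b Cinfinite_Cnotzero[THEN Cnotzero_imp_not_empty, OF Cinfinite_b]] .

lemma Pow_ordLeq_b:
  assumes "|X| \<le>o b n"
  shows "|Pow X| \<le>o b (Suc n)"
proof (cases "X = {}")
  case True
  then show ?thesis using singl_ordLeq_b by simp
next
  case False
  have "|Pow X| =o ctwo ^c |X|"
    using card_of_Pow_Func[of X] by (simp add: cexp_def ctwo_def Field_card_of)
  also have "ctwo ^c |X| \<le>o ctwo ^c b n"
    by (rule cexp_mono2'[OF assms Card_order_ctwo])
       (use False in \<open>simp add: Field_card_of\<close>)
  also have "ctwo ^c b n =o b (Suc n)" by (rule ordIso_symmetric[OF Suc_b])
  finally show ?thesis .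
qed

text \<open>\<open>(2^\<kappa>)^\<kappa> = 2^\<kappa>\<close> for \<open>\<kappa> = b n\<close>: a
  successor index absorbs exponents up to the preceding member.\<close>

lemma Func_ordLeq_b:
  assumes "Y \<noteq> {}" "|Y| \<le>o b n" "|U| \<le>o b (Suc n)"
  shows "|Func Y U| \<le>o b (Suc n)"
proof -
  have "|Func Y U| = |U| ^c |Y|" by (simp add: cexp_def Field_card_of)
  also have "|U| ^c |Y| \<le>o (ctwo ^c b n) ^c |Y|"
    by (rule cexp_mono1[OF ordLeq_ordIso_trans[OF assms(3) Suc_b] card_of_Card_order])
  also have "(ctwo ^c b n) ^c |Y| =o ctwo ^c b n"
    by (rule cexp_cprod_ordLeq[OF Card_order_ctwo Cinfinite_b _ assms(2)])
       (simp add: card_of_ordIso_czero_iff_empty card_of_card_order_on Field_card_of assms(1))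
  also have "ctwo ^c b n =o b (Suc n)" by (rule ordIso_symmetric[OF Suc_b])
  finally show ?thesis .
qed

section \<open>Small sets and covering families\<close>

text \<open>As \<open>b\<close> increases strictly, this means cardinality less than the supremum of
  the \<open>b n\<close>, expressed without that cardinal.\<close>

definition small :: "'x set \<Rightarrow> bool" where
  "small X \<longleftrightarrow> (\<exists>n. |X| \<le>o b n)"

definition covered :: "nat \<Rightarrow> 'x set \<Rightarrow> bool" where
  "covered n A \<longleftrightarrow> (\<exists>P :: 'x set set. |P| \<le>o |A| \<and> (\<forall>Z\<in>P. small Z) \<and>
     (\<forall>X\<subseteq>A. small X \<longrightarrow> (\<exists>Q\<subseteq>P. |Q| \<le>o b n \<and> X \<subseteq> \<Union>Q)))"

lemma coveredI:
  fixes P :: "'x set set"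
  assumes "|P| \<le>o |A|" "\<And>Z. Z \<in> P \<Longrightarrow> small Z"
    "\<And>X. X \<subseteq> A \<Longrightarrow> small X \<Longrightarrow> \<exists>Q\<subseteq>P. |Q| \<le>o b n \<and> X \<subseteq> \<Union>Q"
  shows "covered n A"
  unfolding covered_def
proof (intro exI[of _ P] conjI)
  show "\<forall>X\<subseteq>A. small X \<longrightarrow> (\<exists>Q\<subseteq>P. |Q| \<le>o b n \<and> X \<subseteq> \<Union>Q)" using assms(3) by simp
qed (use assms(1,2) in auto)

lemma covered_mono:
  fixes A :: "'x set"
  assumes "covered m A" "m \<le> n"
  shows "covered n A"
proof -
  obtain P :: "'x set set" where P: "|P| \<le>o |A|" "\<forall>Z\<in>P. small Z"
    "\<forall>X\<subseteq>A. small X \<longrightarrow> (\<exists>Q\<subseteq>P. |Q| \<le>o b m \<and> X \<subseteq> \<Union>Q)"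
    using assms(1) unfolding covered_def by auto
  show ?thesis
  proof (rule coveredI[OF P(1)])
    fix X assume "X \<subseteq> A" "small X"
    then obtain Q where "Q \<subseteq> P" "|Q| \<le>o b m" "X \<subseteq> \<Union>Q" using P(3) by auto
    then show "\<exists>Q\<subseteq>P. |Q| \<le>o b n \<and> X \<subseteq> \<Union>Q"
      using ordLeq_transitive[OF _ b_mono[OF assms(2)]] by (intro exI[of _ Q]) simp
  qed (use P(2) in simp)
qed

lemma covered_small:
  assumes "small A"
  shows "covered 0 A"
proof (cases "A = {}")
  case True
  show ?thesis
  proof (rule coveredI[of "{}"])
    show "\<exists>Q\<subseteq>{}. |Q| \<le>o b 0 \<and> X \<subseteq> \<Union>Q" if "X \<subseteq> A" for X
      using that True Card_order_empty[OF Card_order_b] by auto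
  qed (auto simp: card_of_empty)
next
  case False
  show ?thesis
  proof (rule coveredI[OF card_of_singl_ordLeq[OF False]])
    show "\<exists>Q\<subseteq>{A}. |Q| \<le>o b 0 \<and> X \<subseteq> \<Union>Q" if "X \<subseteq> A" for X
      using that singl_ordLeq_b[of A 0] by (intro exI[of _ "{A}"]) simp
  qed (use assms in simp)
qed

lemma infinite_if_b_ordLeq:
  assumes "\<And>n. b n \<le>o |A|"
  shows "infinite A"
  using cinfinite_mono[OF assms[of 0]] Cinfinite_0 by (simp add: cinfinite_def Field_card_of)

lemma small_ordLess:
  assumes "\<And>n. b n \<le>o |A|" "|X| \<le>o b n"
  shows "|X| <o |A|"
  using ordLeq_ordLess_trans[OF assms(2) ordLess_ordLeq_trans[OF b_ordLess_Suc assms(1)]] .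

lemma small_ordLeq:
  assumes "\<And>n. b n \<le>o |A|" "small X"
  shows "|X| \<le>o |A|"
  using small_ordLess[OF assms(1)] assms(2) ordLess_imp_ordLeq unfolding small_def by blast

section \<open>Existence of coverings by induction on cardinality\<close>

text \<open>Otherwise maximal families have at most \<open>|A|\<close> members. The images of their
  functions, over one set \<open>Y m\<close> of each size \<open>b m\<close> and all ideals on it,
  then form a family witnessing \<open>covered 0 A\<close>.\<close>

lemma not_covered_family:
  fixes A :: "'a set"
  assumes A: "\<And>n. b n \<le>o |A|" and not: "\<not> covered 0 A"
  obtains Y :: "'a set" and m J and H :: "('a \<Rightarrow> 'a) set" where
    "infinite Y" "|Y| \<le>o b m" "sigma_ideal Y J"
    "J_different Y J H" "\<And>h. h \<in> H \<Longrightarrow> h ` Y \<subseteq> A" "\<not> |H| \<le>o |A|"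
proof (rule ccontr)
  note family = that
  assume neg: "\<not> thesis"
  have bound: "|H| \<le>o |A|"
    if "infinite Y" "|Y| \<le>o b m" "sigma_ideal Y J" "J_different Y J H" "\<And>h. h \<in> H \<Longrightarrow> h ` Y \<subseteq> A"
    for Y :: "'a set" and m J and H :: "('a \<Rightarrow> 'a) set"
    using family[OF that] neg by blast
  have infA: "infinite A" using A by (rule infinite_if_b_ordLeq)
  have "\<exists>Y. Y \<subseteq> A \<and> |Y| =o b m" for m
    using ex_subset_of_card[OF A Card_order_b] by auto
  then obtain Y where Y: "\<And>m. Y m \<subseteq> A" "\<And>m. |Y m| =o b m" by metis
  have infY: "infinite (Y m)" for m
    using Cinfinite_cong[OF ordIso_symmetric[OF Y(2)] Cinfinite_b]
    by (simp add: cinfinite_def Field_card_of)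
  let ?F = "\<lambda>m. {h :: 'a \<Rightarrow> 'a. h ` Y m \<subseteq> A}"
  define good where "good m J M \<longleftrightarrow> M \<subseteq> ?F m \<and> J_different (Y m) J M \<and>
    (\<forall>h\<in>?F m. \<exists>g\<in>M. {y \<in> Y m. g y = h y} \<notin> J)" for m J M
  have "\<exists>M. good m J M" if "sigma_ideal (Y m) J" for m J
    using maximal_J_different[of "Y m" J "?F m"] that unfolding sigma_ideal_def good_def by blast
  then obtain M where "\<And>m J. sigma_ideal (Y m) J \<Longrightarrow> good m J (M m J)" by metis
  then have M: "\<And>m J. sigma_ideal (Y m) J \<Longrightarrow> M m J \<subseteq> ?F m"
    "\<And>m J. sigma_ideal (Y m) J \<Longrightarrow> J_different (Y m) J (M m J)"
    "\<And>m J h. sigma_ideal (Y m) J \<Longrightarrow> h \<in> ?F m \<Longrightarrow> \<exists>g\<in>M m J. {y \<in> Y m. g y = h y} \<notin> J"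
    unfolding good_def by blast+
  define P where "P = (\<Union>m. \<Union>J\<in>Collect (sigma_ideal (Y m)). (\<lambda>h. h ` Y m) ` M m J)"
  have P_card: "|P| \<le>o |A|"
    unfolding P_def
  proof (intro card_of_UNION_ordLeq_infinite[OF infA] ballI)
    show "|UNIV :: nat set| \<le>o |A|" by (rule ordLeq_transitive[OF nat_ordLeq_b A])
    fix m
    \<comment> \<open>This bounds the number of ideals on \<open>Y m\<close>; two exponentials cost
      two steps in \<open>b\<close>.\<close>
    have "|Pow (Pow (Y m))| \<le>o |A|"
      using Pow_ordLeq_b[OF Pow_ordLeq_b[OF ordIso_imp_ordLeq[OF Y(2)]]] A ordLeq_transitive by blast
    moreover have "Collect (sigma_ideal (Y m)) \<subseteq> Pow (Pow (Y m))"
      by (intro subsetI) (simp add: sigma_ideal_def)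
    ultimately show "|Collect (sigma_ideal (Y m))| \<le>o |A|"
      by (rule card_of_subset_le[rotated])
    fix J assume "J \<in> Collect (sigma_ideal (Y m))"
    then have "|M m J| \<le>o |A|"
      using M(1,2)[of m J] infY Y(2) by (intro bound[of "Y m" m J]) (auto intro: ordIso_imp_ordLeq)
    then show "|(\<lambda>h. h ` Y m) ` M m J| \<le>o |A|" by (rule ordLeq_transitive[OF card_of_image])
  qed
  have P_small: "small Z" if Z: "Z \<in> P" for Z
  proof -
    obtain m h where "Z = h ` Y m" using Z by (auto simp: P_def)
    then have "|Z| \<le>o b m"
      using ordLeq_ordIso_trans[OF card_of_image Y(2)] by blast
    then show ?thesis by (auto simp: small_def)
  qed
  have P_cover: "\<exists>Q\<subseteq>P. |Q| \<le>o b 0 \<and> X \<subseteq> \<Union>Q" if X: "X \<subseteq> A" "small X" for X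
  proof (cases "X = {}")
    case True
    have "|{} :: 'a set set| \<le>o b 0" by (rule Card_order_empty[OF Card_order_b])
    then show ?thesis using True by blast
  next
    case False
    obtain m where "|X| \<le>o b m" using X(2) by (auto simp: small_def)
    from ordLeq_ordIso_trans[OF this ordIso_symmetric[OF Y(2)]] have "|X| \<le>o |Y m|" .
    then have "\<exists>e. e ` Y m = X" by (rule iffD2[OF card_of_ordLeq2[OF False]])
    then obtain e where e: "e ` Y m = X" ..
    \<comment> \<open>If \<open>X\<close> is not covered by \<open>b 0\<close> members of
      \<open>P\<close>, the subsets of \<open>Y m\<close> with covered image under \<open>e\<close>
      form a proper ideal, to which the choice of \<open>M\<close> applies.\<close>
    define J where "J = {S. S \<subseteq> Y m \<and> (\<exists>Q\<subseteq>P. |Q| \<le>o b 0 \<and> e ` S \<subseteq> \<Union>Q)}"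
    show ?thesis
    proof (cases "Y m \<in> J")
      case True
      then show ?thesis using e by (auto simp: J_def)
    next
      case notin: False
      have J: "sigma_ideal (Y m) J"
        unfolding sigma_ideal_def
      proof (intro conjI allI impI ballI)
        show "J \<subseteq> Pow (Y m)" by (auto simp: J_def)
        have "|{} :: 'a set set| \<le>o b 0" by (rule Card_order_empty[OF Card_order_b])
        then show "{} \<in> J" by (auto simp: J_def)
        show "S \<in> J" if "T \<in> J" "S \<subseteq> T" for S T
        proof -
          obtain Q where "T \<subseteq> Y m" "Q \<subseteq> P" "|Q| \<le>o b 0" "e ` T \<subseteq> \<Union>Q"
            using \<open>T \<in> J\<close> unfolding J_def by auto
          moreover have "S \<subseteq> Y m" "e ` S \<subseteq> \<Union>Q"
            using subset_trans[OF that(2)] subset_trans[OF image_mono[OF that(2)]] calculation by simp_all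
          ultimately show ?thesis unfolding J_def by auto
        qed
        show "Y m \<notin> J" by (rule notin)
        fix T :: "nat \<Rightarrow> 'a set" assume T: "range T \<subseteq> J"
        then have "\<forall>n. \<exists>Q. Q \<subseteq> P \<and> |Q| \<le>o b 0 \<and> e ` T n \<subseteq> \<Union>Q" unfolding J_def by blast
        then obtain Q where Q: "\<And>n. Q n \<subseteq> P" "\<And>n. |Q n| \<le>o b 0" "\<And>n. e ` T n \<subseteq> \<Union>(Q n)" by metis
        have "|\<Union>n. Q n| \<le>o b 0"
          by (rule UNION_Cinfinite_bound[OF nat_ordLeq_b _ Cinfinite_0]) (simp add: Q(2))
        moreover have "e ` (\<Union>n. T n) \<subseteq> \<Union>(\<Union>n. Q n)" using Q(3) by blast
        moreover have "(\<Union>n. Q n) \<subseteq> P" using Q(1) by blast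
        moreover have "(\<Union>n. T n) \<subseteq> Y m" using T by (auto simp: J_def)
        ultimately show "(\<Union>n. T n) \<in> J" unfolding J_def by auto
      qed
      \<comment> \<open>On a positive set \<open>e\<close> agrees with \<open>g\<close>, so the
        image of that set lies in the range of \<open>g\<close> on \<open>Y m\<close>. This is a
        single member of \<open>P\<close>, which puts the set into \<open>J\<close>.\<close>
      obtain g where g: "g \<in> M m J" "{y \<in> Y m. g y = e y} \<notin> J"
        using M(3)[OF J, of e] e X(1) by auto
      have "e ` {y \<in> Y m. g y = e y} \<subseteq> g ` Y m" by force
      moreover have "g ` Y m \<in> P" using g(1) J by (auto simp: P_def)
      ultimately have "{y \<in> Y m. g y = e y} \<in> J"
        using singl_ordLeq_b[of "g ` Y m" 0] unfolding J_def
        by (auto intro!: exI[of _ "{g ` Y m}"])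
      then show ?thesis using g(2) by blast
    qed
  qed
  have "covered 0 A"
    by (rule coveredI[OF P_card P_small P_cover])
  then show False using not by blast
qed

text \<open>
  Here \<open>\<phi>\<close> embeds \<open>A\<close> into the product of the sets \<open>I y\<close> modulo \<open>J\<close>. Choosing for \<open>\<xi>\<close> at each \<open>y\<close> a
  member of the family for \<open>I y\<close> that contains \<open>\<phi> \<xi> y\<close> gives only \<open>(b (Suc n))\<^bsup>|Y|\<^esup> = b (Suc n)\<close>
  functions for all \<open>\<xi>\<close> in a small set, and \<open>bound\<close> replaces them, up to agreement on a positive set,
  by functions from one collection \<open>M\<close> of size \<open>|A|\<close>.
\<close>

lemma covered_if_exact:
  fixes A Y :: "'a set" and I :: "'a \<Rightarrow> 'a set"
  assumes A: "\<And>n. b n \<le>o |A|"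
    and J: "sigma_ideal Y J" and Y: "|Y| \<le>o b m"
    and I: "\<And>y. y \<in> Y \<Longrightarrow> covered (Suc n) (I y)" and mn: "m \<le> n"
    and \<phi>: "\<And>\<xi>. \<xi> \<in> A \<Longrightarrow> {y \<in> Y. \<phi> \<xi> y \<notin> I y} \<in> J"
      "\<And>\<xi> \<zeta>. \<xi> \<in> A \<Longrightarrow> \<zeta> \<in> A \<Longrightarrow> \<xi> \<noteq> \<zeta> \<Longrightarrow> {y \<in> Y. \<phi> \<xi> y = \<phi> \<zeta> y} \<in> J"
    and IA: "\<And>y. y \<in> Y \<Longrightarrow> I y \<subseteq> A"
    and bound: "\<And>H :: ('a \<Rightarrow> 'a) set. J_different Y J H \<Longrightarrow>
      (\<And>h. h \<in> H \<Longrightarrow> h ` Y \<subseteq> A \<and> {y \<in> Y. h y \<notin> I y} \<in> J) \<Longrightarrow> |H| \<le>o |A|"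
  shows "covered (Suc n) A"
proof -
  have infA: "infinite A" using A by (rule infinite_if_b_ordLeq)
  have YJ: "Y \<notin> J" and Yne: "Y \<noteq> {}" using J by (auto simp: sigma_ideal_def)
  have Yn: "|Y| \<le>o b n" using Y b_mono[OF mn] ordLeq_transitive by blast
  have "\<forall>y\<in>Y. \<exists>P. |P| \<le>o |I y| \<and> (\<forall>Z\<in>P. small Z) \<and>
      (\<forall>X\<subseteq>I y. small X \<longrightarrow> (\<exists>Q\<subseteq>P. |Q| \<le>o b (Suc n) \<and> X \<subseteq> \<Union>Q))"
    using I unfolding covered_def by blast
  from bchoice[OF this] obtain P where P0: "\<forall>y\<in>Y. |P y| \<le>o |I y| \<and> (\<forall>Z\<in>P y. small Z) \<and>
      (\<forall>X\<subseteq>I y. small X \<longrightarrow> (\<exists>Q\<subseteq>P y. |Q| \<le>o b (Suc n) \<and> X \<subseteq> \<Union>Q))" ..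
  have P: "|P y| \<le>o |I y|" "Z \<in> P y \<Longrightarrow> small Z"
    "X \<subseteq> I y \<Longrightarrow> small X \<Longrightarrow> \<exists>Q\<subseteq>P y. |Q| \<le>o b (Suc n) \<and> X \<subseteq> \<Union>Q" if "y \<in> Y" for y Z X
    using bspec[OF P0 that] by blast+
  have "\<forall>y\<in>Y. \<exists>\<iota>. inj_on \<iota> (P y) \<and> \<iota> ` P y \<subseteq> I y"
    using P(1) by (simp add: card_of_ordLeq)
  from bchoice[OF this] obtain \<iota> where "\<forall>y\<in>Y. inj_on (\<iota> y) (P y) \<and> \<iota> y ` P y \<subseteq> I y" ..
  then have \<iota>: "\<And>y. y \<in> Y \<Longrightarrow> inj_on (\<iota> y) (P y)" "\<And>y. y \<in> Y \<Longrightarrow> \<iota> y ` P y \<subseteq> I y"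
    by simp_all
  let ?F = "{G :: 'a \<Rightarrow> 'a set. {y \<in> Y. G y \<notin> P y} \<in> J}"
  obtain M where M: "M \<subseteq> ?F" "J_different Y J M" "\<And>G. G \<in> ?F \<Longrightarrow> \<exists>G'\<in>M. {y \<in> Y. G' y = G y} \<notin> J"
    using maximal_J_different[OF YJ, of ?F] by blast
  have "|M| \<le>o |A|"
  proof -
    obtain a where a: "a \<in> A" using infA by fastforce
    \<comment> \<open>The injections \<open>\<iota> y\<close> turn \<open>G\<close> into a function
      to which \<open>bound\<close> applies; within \<open>Y\<close> the default \<open>a\<close>
      occurs only on a set in \<open>J\<close>.\<close>
    let ?t = "\<lambda>G y. if G y \<in> P y then \<iota> y (G y) else a"
    have d: "{y \<in> Y. ?t G y = ?t G' y} \<in> J" if "G \<in> M" "G' \<in> M" "G \<noteq> G'" for G G'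
    proof -
      have "{y \<in> Y. G y = G' y} \<union> ({y \<in> Y. G y \<notin> P y} \<union> {y \<in> Y. G' y \<notin> P y}) \<in> J"
        using that M(1) by (intro sigma_ideal_Un[OF J] J_differentD[OF M(2)]) auto
      moreover have "{y \<in> Y. ?t G y = ?t G' y} \<subseteq>
          {y \<in> Y. G y = G' y} \<union> ({y \<in> Y. G y \<notin> P y} \<union> {y \<in> Y. G' y \<notin> P y})"
        using \<iota>(1) by (auto dest: inj_onD)
      ultimately show ?thesis by (rule sigma_ideal_subset[OF J])
    qed
    have "inj_on ?t M"
    proof (rule inj_onI, rule ccontr)
      fix G G' assume "G \<in> M" "G' \<in> M" "?t G = ?t G'" "G \<noteq> G'"
      then show False using d[of G G'] YJ by (simp add: fun_eq_iff)
    qed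
    moreover have "|?t ` M| \<le>o |A|"
    proof (rule bound)
      show "J_different Y J (?t ` M)" using d unfolding J_different_def by blast
      fix h assume "h \<in> ?t ` M"
      then obtain G where G: "G \<in> M" "h = ?t G" by blast
      have "h y \<in> I y" if "y \<in> Y" "G y \<in> P y" for y
        using \<iota>(2)[OF that(1)] that(2) G(2) by (simp add: image_subset_iff)
      then have "{y \<in> Y. h y \<notin> I y} \<subseteq> {y \<in> Y. G y \<notin> P y}" by blast
      moreover have "{y \<in> Y. G y \<notin> P y} \<in> J" using G(1) M(1) by auto
      ultimately have "{y \<in> Y. h y \<notin> I y} \<in> J" by (rule sigma_ideal_subset[OF J, rotated])
      moreover have "h y \<in> A" if y: "y \<in> Y" for y
        using \<iota>(2)[OF y] IA[OF y] a G(2) by (cases "G y \<in> P y") (auto simp: image_subset_iff)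
      ultimately show "h ` Y \<subseteq> A \<and> {y \<in> Y. h y \<notin> I y} \<in> J" by auto
    qed
    ultimately show ?thesis using card_of_ordLeqI[of ?t M "?t ` M"] ordLeq_transitive by blast
  qed
  \<comment> \<open>The sizes of the sets \<open>G y\<close> need not have a common bound
    \<open>b k\<close>, so only points with \<open>|G y| \<le>o b k\<close> are used. This keeps
    \<open>W G k\<close> small: \<xi> is determined by the trace of \<open>\<phi> \<xi>\<close> on
    \<open>G\<close> over those points.\<close>
  define W where "W G k = {\<xi> \<in> A. {y \<in> Y. \<phi> \<xi> y \<in> G y \<and> |G y| \<le>o b k} \<notin> J}"
    for G :: "'a \<Rightarrow> 'a set" and k
  have W_small: "small (W G k)" for G k
  proof -
    let ?Y = "{y \<in> Y. |G y| \<le>o b k}"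
    let ?t = "\<lambda>\<xi>. {(y, \<phi> \<xi> y) |y. y \<in> ?Y \<and> \<phi> \<xi> y \<in> G y}"
    have "|Sigma ?Y G| \<le>o b (max m k)"
    proof (rule card_of_Sigma_ordLeq_infinite_Field)
      show "infinite (Field (b (max m k)))" using Cinfinite_b by (auto simp: cinfinite_def)
      show "|?Y| \<le>o b (max m k)"
        by (rule card_of_subset_le[OF _ ordLeq_transitive[OF Y b_mono]]) auto
      show "\<forall>y\<in>?Y. |G y| \<le>o b (max m k)"
        by (intro ballI ordLeq_transitive[OF _ b_mono[of k "max m k"]]) simp_all
    qed (rule Card_order_b)
    then have "|Pow (Sigma ?Y G)| \<le>o b (Suc (max m k))" by (rule Pow_ordLeq_b)
    moreover have "inj_on ?t (W G k)"
    proof (rule inj_onI, rule ccontr)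
      fix \<xi> \<zeta> assume *: "\<xi> \<in> W G k" "\<zeta> \<in> W G k" "?t \<xi> = ?t \<zeta>" "\<xi> \<noteq> \<zeta>"
      have "{y \<in> Y. \<phi> \<xi> y \<in> G y \<and> |G y| \<le>o b k} \<subseteq> {y \<in> Y. \<phi> \<xi> y = \<phi> \<zeta> y}"
      proof
        fix y assume y: "y \<in> {y \<in> Y. \<phi> \<xi> y \<in> G y \<and> |G y| \<le>o b k}"
        then have "(y, \<phi> \<xi> y) \<in> ?t \<xi>" by blast
        then have "(y, \<phi> \<xi> y) \<in> ?t \<zeta>" unfolding *(3) .
        then show "y \<in> {y \<in> Y. \<phi> \<xi> y = \<phi> \<zeta> y}" using y by blast
      qed
      then show False using * \<phi>(2)[of \<xi> \<zeta>] sigma_ideal_subset[OF J] by (auto simp: W_def)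
    qed
    then have "|W G k| \<le>o |Pow (Sigma ?Y G)|" by (rule card_of_ordLeqI) auto
    ultimately show ?thesis using ordLeq_transitive unfolding small_def by blast
  qed
  define PA where "PA = (\<lambda>(G, k). W G k) ` (M \<times> (UNIV :: nat set))"
  have PA_card: "|PA| \<le>o |A|"
    unfolding PA_def
    by (rule ordLeq_transitive[OF card_of_image card_of_Times_le[OF infA \<open>|M| \<le>o |A|\<close>
          ordLeq_transitive[OF nat_ordLeq_b A]]])
  have PA_cover: "\<exists>Q\<subseteq>PA. |Q| \<le>o b (Suc n) \<and> X \<subseteq> \<Union>Q" if X: "X \<subseteq> A" "small X" for X
  proof -
    have "\<forall>y\<in>Y. \<exists>Q. Q \<subseteq> P y \<and> |Q| \<le>o b (Suc n) \<and> {\<phi> \<xi> y |\<xi>. \<xi> \<in> X} \<inter> I y \<subseteq> \<Union>Q"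
    proof
      fix y assume y: "y \<in> Y"
      obtain k where "|X| \<le>o b k" using X(2) by (auto simp: small_def)
      moreover have "|{\<phi> \<xi> y |\<xi>. \<xi> \<in> X} \<inter> I y| \<le>o |X|"
        by (rule surj_imp_ordLeq[of _ "\<lambda>\<xi>. \<phi> \<xi> y"]) auto
      ultimately have "small ({\<phi> \<xi> y |\<xi>. \<xi> \<in> X} \<inter> I y)"
        unfolding small_def using ordLeq_transitive by blast
      then show "\<exists>Q. Q \<subseteq> P y \<and> |Q| \<le>o b (Suc n) \<and> {\<phi> \<xi> y |\<xi>. \<xi> \<in> X} \<inter> I y \<subseteq> \<Union>Q"
        using P(3)[OF y, of "{\<phi> \<xi> y |\<xi>. \<xi> \<in> X} \<inter> I y"] by blast
    qed
    from bchoice[OF this] obtain Q where Q0: "\<forall>y\<in>Y. Q y \<subseteq> P y \<and> |Q y| \<le>o b (Suc n) \<and>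
      {\<phi> \<xi> y |\<xi>. \<xi> \<in> X} \<inter> I y \<subseteq> \<Union>(Q y)" ..
  have Q: "Q y \<subseteq> P y" "|Q y| \<le>o b (Suc n)" "{\<phi> \<xi> y |\<xi>. \<xi> \<in> X} \<inter> I y \<subseteq> \<Union>(Q y)"
    if "y \<in> Y" for y
    using bspec[OF Q0 that] by simp_all
    \<comment> \<open>The empty set guarantees a value at points where \<open>\<phi> \<xi> y\<close>
      is outside \<open>I y\<close>.\<close>
    define U where "U = insert {} (\<Union>y\<in>Y. Q y)"
    have "\<forall>\<xi>\<in>X. \<exists>z. z \<in> Func Y U \<and> (\<forall>y\<in>Y. \<phi> \<xi> y \<in> I y \<longrightarrow> \<phi> \<xi> y \<in> z y \<and> z y \<in> Q y)"
    proof
      fix \<xi> assume \<xi>: "\<xi> \<in> X"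
      have "\<forall>y\<in>Y. \<exists>Z. Z \<in> U \<and> (\<phi> \<xi> y \<in> I y \<longrightarrow> \<phi> \<xi> y \<in> Z \<and> Z \<in> Q y)"
      proof
        fix y assume y: "y \<in> Y"
        show "\<exists>Z. Z \<in> U \<and> (\<phi> \<xi> y \<in> I y \<longrightarrow> \<phi> \<xi> y \<in> Z \<and> Z \<in> Q y)"
        proof (cases "\<phi> \<xi> y \<in> I y")
          case True
          then obtain Z where "Z \<in> Q y" "\<phi> \<xi> y \<in> Z" using Q(3)[OF y] \<xi> by blast
          then show ?thesis using y by (auto simp: U_def)
        qed (auto simp: U_def)
      qed
      from bchoice[OF this] obtain z where
        z: "\<forall>y\<in>Y. z y \<in> U \<and> (\<phi> \<xi> y \<in> I y \<longrightarrow> \<phi> \<xi> y \<in> z y \<and> z y \<in> Q y)" ..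
      then show "\<exists>z. z \<in> Func Y U \<and> (\<forall>y\<in>Y. \<phi> \<xi> y \<in> I y \<longrightarrow> \<phi> \<xi> y \<in> z y \<and> z y \<in> Q y)"
        by (intro exI[of _ "\<lambda>y. if y \<in> Y then z y else undefined"]) (simp add: Func_def)
    qed
    from bchoice[OF this] obtain z where z0: "\<forall>\<xi>\<in>X. z \<xi> \<in> Func Y U \<and>
      (\<forall>y\<in>Y. \<phi> \<xi> y \<in> I y \<longrightarrow> \<phi> \<xi> y \<in> z \<xi> y \<and> z \<xi> y \<in> Q y)" ..
    have z: "z \<xi> \<in> Func Y U"
      "y \<in> Y \<Longrightarrow> \<phi> \<xi> y \<in> I y \<Longrightarrow> \<phi> \<xi> y \<in> z \<xi> y \<and> z \<xi> y \<in> Q y" if "\<xi> \<in> X" for \<xi> y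
      using bspec[OF z0 that] by simp_all
    have "|U| \<le>o b (Suc n)"
    proof -
      have "|Y| \<le>o b (Suc n)" using Yn ordLess_imp_ordLeq[OF b_ordLess_Suc] ordLeq_transitive by blast
      then have "|\<Union>y\<in>Y. Q y| \<le>o b (Suc n)"
        by (rule UNION_Cinfinite_bound[OF _ _ Cinfinite_b]) (simp add: Q(2))
      then have "|{{}} \<union> (\<Union>y\<in>Y. Q y)| \<le>o b (Suc n)"
        by (rule Un_Cinfinite_bound[OF singl_ordLeq_b _ Cinfinite_b])
      then show ?thesis by (simp add: U_def)
    qed
    then have "|Func Y U| \<le>o b (Suc n)" by (rule Func_ordLeq_b[OF Yne Yn])
    moreover have "z ` X \<subseteq> Func Y U" using z(1) by blast
    ultimately have zX: "|z ` X| \<le>o b (Suc n)"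
      by (rule card_of_subset_le[rotated])
    have "\<forall>Z. \<exists>G. Z \<in> z ` X \<longrightarrow> G \<in> M \<and> {y \<in> Y. G y = Z y} \<notin> J"
    proof (intro allI)
      fix Z
      show "\<exists>G. Z \<in> z ` X \<longrightarrow> G \<in> M \<and> {y \<in> Y. G y = Z y} \<notin> J"
      proof (cases "Z \<in> z ` X")
        case True
        then obtain \<xi> where \<xi>: "\<xi> \<in> X" "Z = z \<xi>" by blast
        then have "{y \<in> Y. Z y \<notin> P y} \<subseteq> {y \<in> Y. \<phi> \<xi> y \<notin> I y}" using z(2) Q(1) by blast
        then have "Z \<in> ?F" using \<phi>(1)[of \<xi>] \<xi>(1) X(1) sigma_ideal_subset[OF J] by blast
        from M(3)[OF this] show ?thesis by blast
      qed blast
    qed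
    then obtain \<gamma> where \<gamma>: "\<And>Z. Z \<in> z ` X \<Longrightarrow> \<gamma> Z \<in> M" "\<And>Z. Z \<in> z ` X \<Longrightarrow> {y \<in> Y. \<gamma> Z y = Z y} \<notin> J"
      by metis
    define QA where "QA = (\<Union>k. (\<lambda>Z. W (\<gamma> Z) k) ` z ` X)"
    have "|QA| \<le>o b (Suc n)"
      unfolding QA_def
      by (intro UNION_Cinfinite_bound Cinfinite_b nat_ordLeq_b ballI ordLeq_transitive[OF card_of_image zX])
    moreover have "QA \<subseteq> PA" using \<gamma>(1) unfolding QA_def PA_def by force
    moreover have "X \<subseteq> \<Union>QA"
    proof
      fix \<xi> assume \<xi>: "\<xi> \<in> X"
      let ?G = "\<gamma> (z \<xi>)"
      let ?S = "{y \<in> Y. ?G y = z \<xi> y}"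
      let ?T = "\<lambda>k. {y \<in> Y. \<phi> \<xi> y \<in> ?G y \<and> |?G y| \<le>o b k}"
      have S: "?S \<notin> J" using \<gamma>(2)[of "z \<xi>"] \<xi> by blast
      \<comment> \<open>Removing the points where \<open>\<phi> \<xi>\<close> leaves
        \<open>I\<close> keeps \<open>?S\<close> positive. The rest is covered by countably many
        sets \<open>?T k\<close>, so one of these is positive and places \<xi> in
        \<open>W ?G k\<close>.\<close>
      have "{y \<in> ?S. \<phi> \<xi> y \<in> I y} \<notin> J"
        by (rule sigma_ideal_Int_positive[OF J _ S \<phi>(1)]) (use \<xi> X(1) in auto)
      moreover have "{y \<in> ?S. \<phi> \<xi> y \<in> I y} \<subseteq> (\<Union>k. ?T k)"
      proof
        fix y assume y: "y \<in> {y \<in> ?S. \<phi> \<xi> y \<in> I y}"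
        then have "\<phi> \<xi> y \<in> ?G y" "?G y \<in> P y" using z(2)[OF \<xi>, of y] Q(1)[of y] by auto
        moreover from this(2) y obtain k where "|?G y| \<le>o b k" using P(2)[of y] by (auto simp: small_def)
        ultimately show "y \<in> (\<Union>k. ?T k)" using y by blast
      qed
      ultimately have "(\<Union>k. ?T k) \<notin> J" using sigma_ideal_subset[OF J] by blast
      then obtain k where "?T k \<notin> J" using sigma_ideal_UN[OF J, of ?T] by blast
      then have "\<xi> \<in> W ?G k" using \<xi> X(1) by (auto simp: W_def)
      then show "\<xi> \<in> \<Union>QA" using \<xi> unfolding QA_def by blast
    qed
    ultimately show ?thesis by blast
  qed
  have PA_small: "small Z" if "Z \<in> PA" for Z using that W_small by (auto simp: PA_def)
  show ?thesis
    by (rule coveredI[OF PA_card PA_small PA_cover])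
qed

lemma not_ordLeq_b: "\<not> |X| \<le>o b n \<longleftrightarrow> b n <o |X|"
  by (rule not_ordLeq_iff_ordLess[OF card_order_on_well_order_on[OF Card_order_b] card_of_Well_order])

lemma not_b_ordLeq: "\<not> b n \<le>o |X| \<longleftrightarrow> |X| <o b n"
  by (rule not_ordLeq_iff_ordLess[OF card_of_Well_order card_order_on_well_order_on[OF Card_order_b]])

theorem ex_covered:
  fixes A :: "'a set"
  shows "\<exists>n. covered n A"
proof (induction A rule: wf_induct_rule[OF wf_inv_image[OF wf_ordLess, of card_of]])
  case (1 A)
  have IH: "\<exists>n. covered n B" if "|B| <o |A|" for B :: "'a set" using 1[of B] that by simp
  show ?case
  proof (cases "\<forall>n. b n \<le>o |A|")
    case False
    then obtain n where "\<not> b n \<le>o |A|" by blast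
    then have "small A" unfolding not_b_ordLeq small_def using ordLess_imp_ordLeq by blast
    then show ?thesis using covered_small by blast
  next
    case True
    then have A: "\<And>n. b n \<le>o |A|" by blast
    show ?thesis
    proof (cases "covered 0 A")
      case False
      obtain Y :: "'a set" and m J and H :: "('a \<Rightarrow> 'a) set" where
        Y: "infinite Y" "|Y| \<le>o b m" and J: "sigma_ideal Y J" and
        H: "J_different Y J H" "\<And>h. h \<in> H \<Longrightarrow> h ` Y \<subseteq> A" "\<not> |H| \<le>o |A|"
        using not_covered_family[OF A False] by blast
      have PY: "|Pow Y| <o |A|" by (rule small_ordLess[OF A Pow_ordLeq_b[OF Y(2)]])
      obtain f where f: "f ` Y \<subseteq> A" "\<not> J_small Y J |A| f" and
        f_bound: "\<And>G. J_different Y J G \<Longrightarrow>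
          (\<And>g. g \<in> G \<Longrightarrow> g ` Y \<subseteq> A \<and> J_less Y J |A| g f) \<Longrightarrow> |G| \<le>o |A|"
        using exists_minimal_not_J_small[OF J Y(1) ordLess_imp_ordLeq[OF PY] H] by blast
      obtain \<phi> where \<phi>: "\<And>\<xi>. \<xi> \<in> A \<Longrightarrow> \<phi> \<xi> ` Y \<subseteq> A \<and> J_less Y J |A| (\<phi> \<xi>) f"
        "\<And>\<xi> \<zeta>. \<xi> \<in> A \<Longrightarrow> \<zeta> \<in> A \<Longrightarrow> \<xi> \<noteq> \<zeta> \<Longrightarrow> {y \<in> Y. \<phi> \<xi> y = \<phi> \<zeta> y} \<in> J"
        using not_J_small_family[OF J Y(1) PY f(2)] by blast
      let ?I = "\<lambda>y. underS |A| (f y)"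
      have "\<exists>n. covered n (?I y)" if "y \<in> Y" for y
        using that f(1) by (intro IH card_of_underS[OF card_of_Card_order]) (auto simp: Field_card_of)
      then obtain n where n: "\<And>y. y \<in> Y \<Longrightarrow> covered (n y) (?I y)" by metis
      have "A \<noteq> {}" using infinite_if_b_ordLeq[OF A] by auto
      then obtain k where k: "{y \<in> Y. n y = k} \<notin> J" and
        k_bound: "\<And>G. J_different {y \<in> Y. n y = k} (J \<inter> Pow {y \<in> Y. n y = k}) G \<Longrightarrow>
         (\<And>g. g \<in> G \<Longrightarrow> g ` {y \<in> Y. n y = k} \<subseteq> A \<and>
          J_less {y \<in> Y. n y = k} (J \<inter> Pow {y \<in> Y. n y = k}) |A| g f) \<Longrightarrow> |G| \<le>o |A|"
        using bounded_on_positive_fibre[OF J _ f_bound, where n = n] by blast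
      define S where "S = {y \<in> Y. n y = k}"
      have S: "S \<subseteq> Y" "S \<notin> J" using k by (auto simp: S_def)
      have sub: "{y \<in> S. Q y} \<in> J \<inter> Pow S" if "{y \<in> Y. Q y} \<in> J" for Q
      proof -
        have "{y \<in> S. Q y} \<subseteq> {y \<in> Y. Q y}" using S(1) by blast
        then show ?thesis using sigma_ideal_subset[OF J that] by blast
      qed
      \<comment> \<open>\<open>k\<close> serves all segments over \<open>S\<close>, and
        \<open>m\<close> bounds \<open>|S|\<close>; with the successor, powers with exponent
        \<open>|S|\<close> are absorbed.\<close>
      have "covered (Suc (max m k)) A"
      proof (rule covered_if_exact[OF A sigma_ideal_Int_Pow[OF J S], where m = m and I = ?I and \<phi> = \<phi>])
        show "|S| \<le>o b m" by (rule card_of_subset_le[OF S(1) Y(2)])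
        show "covered (Suc (max m k)) (?I y)" if "y \<in> S" for y
          using that n[of y] by (auto simp: S_def intro: covered_mono)
        show "{y \<in> S. \<phi> \<xi> y \<notin> ?I y} \<in> J \<inter> Pow S" if "\<xi> \<in> A" for \<xi>
          using \<phi>(1)[OF that] by (intro sub) (simp add: J_less_def)
        show "{y \<in> S. \<phi> \<xi> y = \<phi> \<zeta> y} \<in> J \<inter> Pow S" if "\<xi> \<in> A" "\<zeta> \<in> A" "\<xi> \<noteq> \<zeta>" for \<xi> \<zeta>
          by (intro sub \<phi>(2) that)
        show "?I y \<subseteq> A" for y
          using FieldI1[of _ "f y" "|A|"] unfolding Field_card_of underS_def by blast
        show "|G| \<le>o |A|" if "J_different S (J \<inter> Pow S) G"
          "\<And>g. g \<in> G \<Longrightarrow> g ` S \<subseteq> A \<and> {y \<in> S. g y \<notin> ?I y} \<in> J \<inter> Pow S" for G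
          using k_bound[folded S_def, OF that(1)] that(2) by (simp add: J_less_def)
      qed simp
      then show ?thesis by blast
    qed blast
  qed
qed

lemma covered_cong:
  fixes A A' :: "'x set"
  assumes "|A| =o |A'|" "covered n A"
  shows "covered n A'"
proof -
  obtain f where f: "bij_betw f A A'" using assms(1) card_of_ordIso[of A A'] by auto
  obtain P :: "'x set set" where P: "|P| \<le>o |A|" "\<forall>Z\<in>P. small Z"
    "\<forall>X\<subseteq>A. small X \<longrightarrow> (\<exists>Q\<subseteq>P. |Q| \<le>o b n \<and> X \<subseteq> \<Union>Q)"
    using assms(2) unfolding covered_def by auto
  show ?thesis
  proof (rule coveredI[of "image f ` P"])
    show "|image f ` P| \<le>o |A'|"
      by (rule ordLeq_transitive[OF card_of_image ordLeq_ordIso_trans[OF P(1) assms(1)]])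
    show "small Z" if "Z \<in> image f ` P" for Z
      using that P(2) ordLeq_transitive[OF card_of_image] by (auto simp: small_def) blast
    fix X assume X: "X \<subseteq> A'" "small X"
    let ?X = "{x \<in> A. f x \<in> X}"
    have "|?X| \<le>o |X|" using f by (intro card_of_ordLeqI[of f]) (auto simp: bij_betw_def inj_on_def)
    then have "small ?X" using X(2) ordLeq_transitive unfolding small_def by blast
    then obtain Q where Q: "Q \<subseteq> P" "|Q| \<le>o b n" "?X \<subseteq> \<Union>Q"
      using P(3)[rule_format, of ?X] by auto
    have "X \<subseteq> f ` ?X" using X(1) f by (auto simp: bij_betw_def)
    also have "\<dots> \<subseteq> \<Union>(image f ` Q)" using Q(3) by blast
    finally show "\<exists>Q\<subseteq>image f ` P. |Q| \<le>o b n \<and> X \<subseteq> \<Union>Q"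
      using Q(1) ordLeq_transitive[OF card_of_image Q(2)] by (intro exI[of _ "image f ` Q"]) auto
  qed
qed

section \<open>Closed sets and filtrations\<close>

text \<open>The index controls unions of chains. Since \<mu> has cofinality \<omega>, a set of size
  \<mu> may meet each member of a countable chain in fewer than \<mu> points, whereas a set larger
  than \<open>b (Suc n)\<close> meets some member in more than \<open>b n\<close>.\<close>

definition b_closed :: "'x set \<Rightarrow> ('x set \<Rightarrow> 'x set) \<Rightarrow> nat \<Rightarrow> 'x set \<Rightarrow> bool" where
  "b_closed V F n D \<longleftrightarrow> D \<subseteq> V \<and> (\<forall>Y\<subseteq>D. b n <o |Y| \<longrightarrow> F Y \<subseteq> D)"

lemma UN_not_ordLeq_b:
  assumes "b n <o |\<Union>i\<in>I. X i|" "|I| \<le>o b n"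
  obtains i where "i \<in> I" "b n <o |X i|"
proof -
  have "\<not> (\<forall>i\<in>I. |X i| \<le>o b n)"
    using UNION_Cinfinite_bound[OF assms(2) _ Cinfinite_b, of X] assms(1) not_ordLeq_b by blast
  then show thesis using that not_ordLeq_b by blast
qed

text \<open>Add \<open>F Y'\<close> for all \<open>Y'\<close> of size \<open>b 0\<close> inside
  members of the covering family. If \<open>|Y|\<close> exceeds \<open>b n\<close>, some member of
  the family contains more than \<open>b n\<close> points of \<open>Y\<close>, hence such a
  \<open>Y' \<subseteq> Y\<close>, and \<open>F Y \<subseteq> F Y'\<close>.\<close>

lemma one_step_closure:
  fixes V A :: "'a set" and F :: "'a set \<Rightarrow> 'a set"
  assumes F: "\<And>Y. Y \<subseteq> V \<Longrightarrow> F Y \<subseteq> V" and anti: "\<And>X Y. X \<subseteq> Y \<Longrightarrow> Y \<subseteq> V \<Longrightarrow> F Y \<subseteq> F X"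
    and F_card: "\<And>Y. Y \<subseteq> V \<Longrightarrow> |Y| =o b 0 \<Longrightarrow> |F Y| \<le>o |A|"
    and A: "\<And>n. b n \<le>o |A|" "A \<subseteq> V" and cov: "covered n A"
  shows "\<exists>A'. A \<subseteq> A' \<and> A' \<subseteq> V \<and> |A'| \<le>o |A| \<and> (\<forall>Y\<subseteq>A. b n <o |Y| \<longrightarrow> F Y \<subseteq> A')"
proof -
  have infA: "infinite A" by (rule infinite_if_b_ordLeq[OF A(1)])
  obtain P :: "'a set set" where P: "|P| \<le>o |A|" "\<forall>Z\<in>P. small Z"
    "\<forall>X\<subseteq>A. small X \<longrightarrow> (\<exists>Q\<subseteq>P. |Q| \<le>o b n \<and> X \<subseteq> \<Union>Q)"
    using cov unfolding covered_def by auto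
  define T where "T Z = {Y. Y \<subseteq> Z \<and> Y \<subseteq> V \<and> |Y| =o b 0}" for Z :: "'a set"
  have T: "|\<Union>(F ` T Z)| \<le>o |A|" if "Z \<in> P" for Z
  proof -
    have "small (Pow Z)" using P(2) that Pow_ordLeq_b unfolding small_def by blast
    then have "|Pow Z| \<le>o |A|" by (rule small_ordLeq[OF A(1)])
    moreover have "T Z \<subseteq> Pow Z" by (auto simp: T_def)
    ultimately have "|T Z| \<le>o |A|" by (rule card_of_subset_le[rotated])
    then show ?thesis
      by (rule card_of_UNION_ordLeq_infinite[OF infA]) (auto simp: T_def intro: F_card)
  qed
  let ?A' = "A \<union> (\<Union>Z\<in>P. \<Union>(F ` T Z))"
  have "|?A'| \<le>o |A|"
    by (intro card_of_Un_le[OF infA] card_of_UNION_ordLeq_infinite[OF infA P(1)] ballI T)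
      (simp add: ordLeq_refl card_of_card_order_on Field_card_of)
  moreover have "?A' \<subseteq> V" using A(2) F by (auto simp: T_def)
  moreover have "F Y \<subseteq> ?A'" if Y: "Y \<subseteq> A" "b n <o |Y|" for Y
  proof -
    \<comment> \<open>Only small sets are known to be covered, so \<open>Y\<close> is first cut down
      to a small set still larger than \<open>b n\<close>.\<close>
    obtain Y0 where Y0: "Y0 \<subseteq> Y" "small Y0" "b n <o |Y0|"
    proof (cases "|Y| \<le>o b (Suc n)")
      case True
      then show thesis using that[of Y] Y(2) by (auto simp: small_def)
    next
      case False
      then have "b (Suc n) \<le>o |Y|" unfolding not_ordLeq_b by (rule ordLess_imp_ordLeq)
      then obtain Z where Z: "Z \<subseteq> Y" "|Z| =o b (Suc n)"
        using ex_subset_of_card[OF _ Card_order_b] by blast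
      have "small Z" using ordIso_imp_ordLeq[OF Z(2)] by (auto simp: small_def)
      moreover have "b n <o |Z|"
        by (rule ordLess_ordIso_trans[OF b_ordLess_Suc ordIso_symmetric[OF Z(2)]])
      ultimately show thesis using that[of Z] Z(1) by blast
    qed
    obtain Q where Q: "Q \<subseteq> P" "|Q| \<le>o b n" "Y0 \<subseteq> \<Union>Q" using P(3) Y0 Y(1) by (meson subset_trans)
    have "(\<Union>Z\<in>Q. Y0 \<inter> Z) = Y0" using Q(3) by blast
    then obtain Z where Z: "Z \<in> Q" "b n <o |Y0 \<inter> Z|"
      using UN_not_ordLeq_b[of n "\<lambda>Z. Y0 \<inter> Z" Q] Y0(3) Q(2) by auto
    have "b 0 \<le>o |Y0 \<inter> Z|" using ordLeq_ordLess_trans[OF b_mono[of 0 n] Z(2)] ordLess_imp_ordLeq by blast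
    then obtain Y' where Y': "Y' \<subseteq> Y0 \<inter> Z" "|Y'| =o b 0"
      using ex_subset_of_card[OF _ Card_order_b] by blast
    have "Y' \<in> T Z" using Y' Y0(1) Y(1) A(2) by (auto simp: T_def)
    then have "F Y' \<subseteq> ?A'" using Z(1) Q(1) by blast
    moreover have "F Y \<subseteq> F Y'" using Y' Y0(1) Y(1) A(2) by (intro anti) auto
    ultimately show ?thesis by blast
  qed
  ultimately show ?thesis by (intro exI[of _ ?A']) auto
qed

text \<open>Iterate the one-step closure \<omega> times. A set larger than \<open>b n\<close> meets
  some stage in more than \<open>b n\<close> points, so anti-monotonicity puts its value into the
  next stage.\<close>

lemma ex_b_closed:
  fixes V A :: "'a set" and F :: "'a set \<Rightarrow> 'a set"
  assumes F: "\<And>Y. Y \<subseteq> V \<Longrightarrow> F Y \<subseteq> V" and anti: "\<And>X Y. X \<subseteq> Y \<Longrightarrow> Y \<subseteq> V \<Longrightarrow> F Y \<subseteq> F X"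
    and F_card: "\<And>Y. Y \<subseteq> V \<Longrightarrow> |Y| =o b 0 \<Longrightarrow> |F Y| \<le>o |A|"
    and A: "\<And>n. b n \<le>o |A|" "A \<subseteq> V"
  shows "\<exists>n D. A \<subseteq> D \<and> |D| \<le>o |A| \<and> b_closed V F n D"
proof -
  have infA: "infinite A" by (rule infinite_if_b_ordLeq[OF A(1)])
  obtain n where n: "covered n A" using ex_covered by blast
  define good where "good X \<longleftrightarrow> A \<subseteq> X \<and> X \<subseteq> V \<and> |X| \<le>o |A|" for X
  have step: "\<exists>X'. good X' \<and> (\<forall>Y\<subseteq>X. b n <o |Y| \<longrightarrow> F Y \<subseteq> X')" if X: "good X" for X
  proof -
    have AX: "|A| \<le>o |X|" using X by (intro card_of_mono1) (simp add: good_def)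
    \<comment> \<open>All stages have the cardinality of \<open>A\<close>, so the index of
      \<open>A\<close> serves every stage.\<close>
    have "|A| =o |X|" using AX X by (simp add: good_def ordIso_iff_ordLeq)
    then have "covered n X" using n by (rule covered_cong)
    then obtain X' where X': "X \<subseteq> X'" "X' \<subseteq> V" "|X'| \<le>o |X|" "\<forall>Y\<subseteq>X. b n <o |Y| \<longrightarrow> F Y \<subseteq> X'"
      using one_step_closure[of V F X n, OF F anti ordLeq_transitive[OF F_card AX]
          ordLeq_transitive[OF A(1) AX]] X by (auto simp: good_def)
    have "good X'" using X X' ordLeq_transitive[OF X'(3)] by (auto simp: good_def)
    then show ?thesis using X'(4) by blast
  qed
  have "good A" using A(2) by (simp add: good_def ordLeq_refl card_of_card_order_on Field_card_of)
  then have "\<exists>B. \<forall>i. good (B i) \<and> (\<forall>Y\<subseteq>B i. b n <o |Y| \<longrightarrow> F Y \<subseteq> B (Suc i))"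
    using step by (intro dependent_nat_choice) auto
  then obtain B where "\<forall>i. good (B i) \<and> (\<forall>Y\<subseteq>B i. b n <o |Y| \<longrightarrow> F Y \<subseteq> B (Suc i))" ..
  from spec[OF this] have B: "good (B i)" "\<forall>Y\<subseteq>B i. b n <o |Y| \<longrightarrow> F Y \<subseteq> B (Suc i)" for i
    by blast+
  have "b_closed V F n (\<Union>i. B i)"
    unfolding b_closed_def
  proof (intro conjI allI impI)
    show V: "(\<Union>i. B i) \<subseteq> V" using B(1) by (auto simp: good_def)
    fix Y assume Y: "Y \<subseteq> (\<Union>i. B i)" "b n <o |Y|"
    have "(\<Union>i. Y \<inter> B i) = Y" using Y(1) by blast
    then obtain i where i: "b n <o |Y \<inter> B i|"
      using UN_not_ordLeq_b[of n "\<lambda>i. Y \<inter> B i" UNIV] Y(2) nat_ordLeq_b by auto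
    have "F Y \<subseteq> F (Y \<inter> B i)" using Y(1) V by (intro anti) auto
    also have "\<dots> \<subseteq> B (Suc i)" using B(2)[of i] i by blast
    finally show "F Y \<subseteq> (\<Union>i. B i)" by blast
  qed
  moreover have "A \<subseteq> (\<Union>i. B i)" using B(1) by (auto simp: good_def)
  moreover have "|\<Union>i. B i| \<le>o |A|"
    using B(1) ordLeq_transitive[OF nat_ordLeq_b A(1)]
    by (intro card_of_UNION_ordLeq_infinite[OF infA]) (auto simp: good_def)
  ultimately show ?thesis by blast
qed

lemma b_closed_Inter:
  assumes "\<D> \<noteq> {}" "\<And>D. D \<in> \<D> \<Longrightarrow> b_closed V F n D"
  shows "b_closed V F n (\<Inter>\<D>)"
  unfolding b_closed_def
proof (intro conjI allI impI Inter_greatest)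
  show "\<Inter>\<D> \<subseteq> V" using assms by (auto simp: b_closed_def)
  fix Y D assume "Y \<subseteq> \<Inter>\<D>" "b n <o |Y|" "D \<in> \<D>"
  moreover from this have "Y \<subseteq> D" by blast
  ultimately show "F Y \<subseteq> D" using assms(2)[of D] by (simp add: b_closed_def)
qed

text \<open>Suppose \<open>Y\<close> meets every member in at most \<open>b n\<close> points. A
  subset \<open>W\<close> of \<open>Y\<close> of size \<open>b (Suc n)\<close> lies in no member, so
  members chosen around the points of \<open>W\<close> are cofinal in the chain. They give
  \<open>|Y| \<le>o b (Suc n)\<close>.\<close>

lemma b_closed_chain_Union:
  assumes anti: "\<And>X Y. X \<subseteq> Y \<Longrightarrow> Y \<subseteq> V \<Longrightarrow> F Y \<subseteq> F X"
    and closed: "\<And>C. C \<in> \<C> \<Longrightarrow> b_closed V F n C"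
    and chain: "\<And>C D. C \<in> \<C> \<Longrightarrow> D \<in> \<C> \<Longrightarrow> C \<subseteq> D \<or> D \<subseteq> C"
  shows "b_closed V F (Suc n) (\<Union>\<C>)"
  unfolding b_closed_def
proof (intro conjI allI impI)
  show V: "\<Union>\<C> \<subseteq> V" using closed by (auto simp: b_closed_def)
  fix Y assume Y: "Y \<subseteq> \<Union>\<C>" "b (Suc n) <o |Y|"
  have "\<exists>C\<in>\<C>. b n <o |Y \<inter> C|"
  proof (rule ccontr)
    assume "\<not> ?thesis"
    then have small: "\<And>C. C \<in> \<C> \<Longrightarrow> |Y \<inter> C| \<le>o b n" using not_ordLeq_b by blast
    obtain W where W: "W \<subseteq> Y" "|W| =o b (Suc n)"
      using ex_subset_of_card[OF ordLess_imp_ordLeq[OF Y(2)] Card_order_b] by blast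
    have "\<forall>w\<in>W. \<exists>C. C \<in> \<C> \<and> w \<in> C" using W(1) Y(1) by blast
    from bchoice[OF this] obtain C where C: "\<forall>w\<in>W. C w \<in> \<C> \<and> w \<in> C w" ..
    have "Y \<subseteq> (\<Union>w\<in>W. Y \<inter> C w)"
    proof
      fix y assume y: "y \<in> Y"
      then obtain D where D: "D \<in> \<C>" "y \<in> D" using Y(1) by blast
      have "\<not> W \<subseteq> D"
      proof
        assume "W \<subseteq> D"
        then have "|W| \<le>o b n" using W(1) by (intro card_of_subset_le[OF _ small[OF D(1)]]) auto
        moreover have "b n <o |W|"
          by (rule ordLess_ordIso_trans[OF b_ordLess_Suc ordIso_symmetric[OF W(2)]])
        ultimately show False using not_ordLeq_b by blast
      qed
      then obtain w where "w \<in> W" "w \<notin> D" by blast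
      then have "D \<subseteq> C w" using C chain[OF D(1), of "C w"] by blast
      then show "y \<in> (\<Union>w\<in>W. Y \<inter> C w)" using y D(2) \<open>w \<in> W\<close> by blast
    qed
    moreover have "|\<Union>w\<in>W. Y \<inter> C w| \<le>o b (Suc n)"
    proof (rule UNION_Cinfinite_bound[OF ordIso_imp_ordLeq[OF W(2)] _ Cinfinite_b])
      show "\<forall>w\<in>W. |Y \<inter> C w| \<le>o b (Suc n)"
      proof
        fix w assume "w \<in> W"
        then have "C w \<in> \<C>" using C by blast
        from ordLeq_transitive[OF small[OF this] ordLess_imp_ordLeq[OF b_ordLess_Suc]]
        show "|Y \<inter> C w| \<le>o b (Suc n)" .
      qed
    qed
    ultimately have "|Y| \<le>o b (Suc n)" by (rule card_of_subset_le)
    then show False using Y(2) not_ordLeq_b by blast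
  qed
  then obtain C where C: "C \<in> \<C>" "b n <o |Y \<inter> C|" by blast
  have "F Y \<subseteq> F (Y \<inter> C)" using Y(1) V by (intro anti) auto
  also have "\<dots> \<subseteq> C" using closed[OF C(1)] C(2) by (auto simp: b_closed_def)
  finally show "F Y \<subseteq> \<Union>\<C>" using C(1) by blast
qed

lemma b_closed_imp_K_closed:
  assumes "b_closed V F n D" "\<And>n. b n \<le>o \<mu>"
  shows "K_closed V F \<mu> D"
  unfolding K_closed_def
proof (intro conjI ballI)
  fix Y assume Y: "Y \<in> subsets_of_card D \<mu>"
  then have "b n <o |Y|"
    using ordLess_ordLeq_trans[OF b_ordLess_Suc assms(2)] ordLess_ordIso_trans ordIso_symmetric
    unfolding subsets_of_card_def by blast
  then show "F Y \<subseteq> D" using assms(1) Y by (auto simp: b_closed_def subsets_of_card_def)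
qed (use assms(1) in \<open>simp add: b_closed_def\<close>)

end

section \<open>Construction of filtrations\<close>

lemma underS_chain:
  assumes "Well_order r" "\<alpha> \<in> Field r" "\<beta> \<in> Field r"
  shows "underS r \<alpha> \<subseteq> underS r \<beta> \<or> underS r \<beta> \<subseteq> underS r \<alpha>"
proof -
  have wo: "wo_rel r" using assms(1) by (simp add: wo_rel_def)
  show ?thesis
    using wo_rel.TOTALS[OF wo] assms(2,3) underS_incr[OF wo_rel.TRANS[OF wo] wo_rel.ANTISYM[OF wo]] by blast
qed

lemma underS_trans_subset:
  assumes "Well_order r" "\<alpha> \<in> underS r \<beta>"
  shows "underS r \<alpha> \<subseteq> underS r \<beta>"
proof -
  have wo: "wo_rel r" using assms(1) by (simp add: wo_rel_def)
  show ?thesis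
    using assms(2) by (intro underS_incr[OF wo_rel.TRANS[OF wo] wo_rel.ANTISYM[OF wo]]) (simp add: underS_def)
qed

text \<open>Hulls of initial segments need not be continuous. Taking at \<alpha> the union of the
  hulls of all earlier segments gives continuity at limits, and the hull of the segment below
  \<alpha> still bounds the size.\<close>

lemma filtration_of_hulls:
  fixes V :: "'a set"
  assumes V: "infinite V"
    and hull: "\<And>X. X \<subseteq> V \<Longrightarrow> X \<subseteq> hull X \<and> hull X \<subseteq> V"
    and hull_mono: "\<And>X Y. X \<subseteq> Y \<Longrightarrow> Y \<subseteq> V \<Longrightarrow> hull X \<subseteq> hull Y"
    and hull_card: "\<And>X. X \<subseteq> V \<Longrightarrow> |X| <o |V| \<Longrightarrow> |hull X| <o |V|"
  shows "filtration V |V| (\<lambda>\<alpha>. \<Union>\<beta>\<in>underS |V| \<alpha>. hull (underS |V| \<beta>))"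
    (is "filtration V ?r ?D")
proof -
  have wo: "Well_order ?r" by (rule card_of_Well_order)
  have u: "underS ?r \<alpha> \<subseteq> V" for \<alpha>
    using FieldI1[of _ \<alpha> "|V|"] unfolding Field_card_of underS_def by blast
  have lim: "\<exists>\<beta>\<in>V. \<alpha> \<in> underS ?r \<beta>" if "\<alpha> \<in> V" for \<alpha>
    using infinite_Card_order_limit[OF card_of_Card_order[of V], of \<alpha>] V that
    by (auto simp: Field_card_of underS_def)
  show ?thesis
    unfolding filtration_def
  proof (intro conjI ballI allI impI)
    show "infinite V" by (rule V)
    show "Card_order ?r" by (rule card_of_Card_order)
    show "|?D \<alpha>| <o ?r" if \<alpha>: "\<alpha> \<in> Field ?r" for \<alpha>
    proof (rule ordLeq_ordLess_trans[OF card_of_mono1 hull_card[OF u card_of_underS[OF card_of_Card_order \<alpha>]]])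
      show "?D \<alpha> \<subseteq> hull (underS ?r \<alpha>)"
        by (intro UN_least hull_mono u underS_trans_subset[OF wo])
    qed
    show "?D \<alpha> \<subseteq> ?D \<beta>" if "\<alpha> \<in> underS ?r \<beta>" for \<alpha> \<beta>
      using underS_trans_subset[OF wo that] by blast
    show "?D \<alpha> = (\<Union>\<beta>\<in>underS ?r \<alpha>. ?D \<beta>)" if \<alpha>: "limit_in ?r \<alpha>" for \<alpha>
    proof
      show "?D \<alpha> \<subseteq> (\<Union>\<beta>\<in>underS ?r \<alpha>. ?D \<beta>)"
      proof
        fix x assume "x \<in> ?D \<alpha>"
        then obtain \<beta> where \<beta>: "\<beta> \<in> underS ?r \<alpha>" "x \<in> hull (underS ?r \<beta>)" by blast
        then obtain \<gamma> where "\<gamma> \<in> underS ?r \<alpha>" "\<beta> \<in> underS ?r \<gamma>"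
          using \<alpha> unfolding limit_in_def by blast
        then show "x \<in> (\<Union>\<beta>\<in>underS ?r \<alpha>. ?D \<beta>)" using \<beta>(2) by blast
      qed
      show "(\<Union>\<beta>\<in>underS ?r \<alpha>. ?D \<beta>) \<subseteq> ?D \<alpha>"
        using underS_trans_subset[OF wo, of _ \<alpha>] by blast
    qed
    show "V = (\<Union>\<alpha>\<in>Field ?r. ?D \<alpha>)"
    proof
      show "V \<subseteq> (\<Union>\<alpha>\<in>Field ?r. ?D \<alpha>)"
      proof
        fix v assume "v \<in> V"
        then obtain \<beta> where \<beta>: "\<beta> \<in> V" "v \<in> underS ?r \<beta>" using lim by blast
        \<comment> \<open>A second step up is made because the member at \<gamma> uses only hulls
          with index below \<gamma>.\<close>
        obtain \<gamma> where "\<gamma> \<in> V" "\<beta> \<in> underS ?r \<gamma>" using lim \<beta>(1) by blast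
        moreover have "v \<in> hull (underS ?r \<beta>)" using hull[OF u] \<beta>(2) by blast
        ultimately show "v \<in> (\<Union>\<alpha>\<in>Field ?r. ?D \<alpha>)" unfolding Field_card_of by blast
      qed
      show "(\<Union>\<alpha>\<in>Field ?r. ?D \<alpha>) \<subseteq> V" using hull[OF u] by blast
    qed
  qed
qed

text \<open>A copy of \<omega> inside the type of \<open>V\<close> serves as length. It has no limit
  elements, so the continuity condition is vacuous.\<close>

lemma filtration_omega:
  fixes V :: "'a set" and C :: "nat \<Rightarrow> 'a set"
  assumes V: "infinite V" and C: "\<And>n. |C n| <o |V|" "\<And>m n. m \<le> n \<Longrightarrow> C m \<subseteq> C n" "(\<Union>n. C n) = V"
  shows "\<exists>(\<kappa> :: 'a rel) N. filtration V \<kappa> (\<lambda>\<alpha>. C (N \<alpha>))"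
proof -
  obtain e :: "nat \<Rightarrow> 'a" where e: "inj e" using V infinite_iff_card_of_nat[of V] card_of_ordLeq[of "UNIV :: nat set" V]
    by auto
  let ?\<kappa> = "|range e|"
  have wo: "Well_order ?\<kappa>" by (rule card_of_Well_order)
  have "|range e| =o |UNIV :: nat set|"
    using card_of_ordIsoI[OF inj_on_imp_bij_betw[OF e]] ordIso_symmetric by blast
  then have \<kappa>: "?\<kappa> =o natLeq" using card_of_nat ordIso_transitive by blast
  have fin: "finite (underS ?\<kappa> \<alpha>)" if "\<alpha> \<in> Field ?\<kappa>" for \<alpha>
    using ordLess_ordIso_trans[OF card_of_underS[OF card_of_Card_order that] \<kappa>]
    by (simp add: finite_iff_ordLess_natLeq)
  \<comment> \<open>\<open>N \<alpha>\<close> is the natural number represented by \<alpha>.\<close>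
  define N where "N \<alpha> = card (underS ?\<kappa> \<alpha>)" for \<alpha>
  have less: "N \<alpha> < N \<beta>" if "\<alpha> \<in> underS ?\<kappa> \<beta>" "\<beta> \<in> Field ?\<kappa>" for \<alpha> \<beta>
  proof -
    have "\<alpha> \<notin> underS ?\<kappa> \<alpha>" by (simp add: underS_def)
    then have "underS ?\<kappa> \<alpha> \<subset> underS ?\<kappa> \<beta>" using underS_trans_subset[OF wo that(1)] that(1) by blast
    then show ?thesis unfolding N_def by (rule psubset_card_mono[OF fin[OF that(2)]])
  qed
  have "inj_on N (Field ?\<kappa>)"
  proof (rule inj_onI, rule ccontr)
    fix \<alpha> \<beta> assume *: "\<alpha> \<in> Field ?\<kappa>" "\<beta> \<in> Field ?\<kappa>" "N \<alpha> = N \<beta>" "\<alpha> \<noteq> \<beta>"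
    then have "(\<alpha>, \<beta>) \<in> ?\<kappa> \<or> (\<beta>, \<alpha>) \<in> ?\<kappa>" using wo_rel.TOTALS[of ?\<kappa>] wo by (simp add: wo_rel_def)
    then have "\<alpha> \<in> underS ?\<kappa> \<beta> \<or> \<beta> \<in> underS ?\<kappa> \<alpha>" using *(4) by (auto simp: underS_def)
    then show False using less * by fastforce
  qed
  moreover have "infinite (Field ?\<kappa>)" using e finite_imageD[of e UNIV] by (auto simp: Field_card_of)
  ultimately have "infinite (N ` Field ?\<kappa>)" using finite_imageD by blast
  then have unbounded: "\<exists>\<alpha>\<in>Field ?\<kappa>. n \<le> N \<alpha>" for n
    unfolding finite_nat_set_iff_bounded_le by (metis image_iff nat_le_linear)
  have no_limit: "\<not> limit_in ?\<kappa> \<alpha>" for \<alpha>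
  proof
    assume l: "limit_in ?\<kappa> \<alpha>"
    let ?S = "underS ?\<kappa> \<alpha>"
    have S: "finite ?S" "?S \<noteq> {}" using l fin by (auto simp: limit_in_def)
    then have "Max (N ` ?S) \<in> N ` ?S" by simp
    then obtain \<beta> where \<beta>: "\<beta> \<in> ?S" "N \<beta> = Max (N ` ?S)" by auto
    then obtain \<gamma> where \<gamma>: "\<gamma> \<in> ?S" "\<beta> \<in> underS ?\<kappa> \<gamma>" using l unfolding limit_in_def by blast
    have "N \<beta> < N \<gamma>" by (rule less[OF \<gamma>(2) underS_Field[OF \<gamma>(1)]])
    moreover have "N \<gamma> \<le> N \<beta>" using \<gamma>(1) S(1) \<beta>(2) by simp
    ultimately show False by simp
  qed
  have "filtration V ?\<kappa> (\<lambda>\<alpha>. C (N \<alpha>))"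
    unfolding filtration_def
  proof (intro conjI ballI allI impI)
    show "infinite V" by (rule V)
    show "Card_order ?\<kappa>" by (rule card_of_Card_order)
    show "|C (N \<alpha>)| <o |V|" for \<alpha> by (rule C(1))
    show "C (N \<alpha>) \<subseteq> C (N \<beta>)" if "\<beta> \<in> Field ?\<kappa>" "\<alpha> \<in> underS ?\<kappa> \<beta>" for \<alpha> \<beta>
      by (rule C(2)[OF less_imp_le[OF less[OF that(2,1)]]])
    show "C (N \<alpha>) = (\<Union>\<beta>\<in>underS ?\<kappa> \<alpha>. C (N \<beta>))" if "limit_in ?\<kappa> \<alpha>" for \<alpha>
      using that no_limit by blast
    show "V = (\<Union>\<alpha>\<in>Field ?\<kappa>. C (N \<alpha>))"
    proof
      show "V \<subseteq> (\<Union>\<alpha>\<in>Field ?\<kappa>. C (N \<alpha>))"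
      proof
        fix v assume "v \<in> V"
        then obtain n where "v \<in> C n" using C(3) by blast
        moreover obtain \<alpha> where "\<alpha> \<in> Field ?\<kappa>" "n \<le> N \<alpha>" using unbounded by blast
        ultimately show "v \<in> (\<Union>\<alpha>\<in>Field ?\<kappa>. C (N \<alpha>))" using C(2)[of n "N \<alpha>"] by blast
      qed
    qed (use C(3) in blast)
  qed
  then show ?thesis by blast
qed

lemma K_closed_Inter:
  assumes "\<D> \<noteq> {}" "\<And>D. D \<in> \<D> \<Longrightarrow> K_closed V F \<mu> D"
  shows "K_closed V F \<mu> (\<Inter>\<D>)"
  unfolding K_closed_def
proof (intro conjI ballI Inter_greatest)
  show "\<Inter>\<D> \<subseteq> V" using assms by (auto simp: K_closed_def)
  fix Y D assume Y: "Y \<in> subsets_of_card (\<Inter>\<D>) \<mu>" and D: "D \<in> \<D>"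
  have "Y \<in> subsets_of_card D \<mu>" using Y D by (auto simp: subsets_of_card_def)
  then show "F Y \<subseteq> D" using assms(2)[OF D] by (simp add: K_closed_def)
qed

context beth_sequence
begin

text \<open>With one index for all smaller sets, intersecting closed supersets gives monotone hulls
  closed at that index. Members of the filtration are unions of chains of hulls, hence closed at
  \<open>Suc n\<close>.\<close>

lemma K_filtrable_if_uniform:
  fixes V :: "'a set" and F :: "'a set \<Rightarrow> 'a set"
  assumes V: "infinite V" and F: "\<And>Y. Y \<subseteq> V \<Longrightarrow> F Y \<subseteq> V"
    and anti: "\<And>X Y. X \<subseteq> Y \<Longrightarrow> Y \<subseteq> V \<Longrightarrow> F Y \<subseteq> F X" and \<mu>: "\<And>n. b n \<le>o \<mu>"
    and ex: "\<And>X. X \<subseteq> V \<Longrightarrow> |X| <o |V| \<Longrightarrow> \<exists>D. X \<subseteq> D \<and> |D| <o |V| \<and> b_closed V F n D"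
  shows "K_filtrable V F \<mu>"
proof -
  define hull where "hull X = \<Inter>{D. X \<subseteq> D \<and> b_closed V F n D}" for X
  have VV: "b_closed V F n V" using F by (simp add: b_closed_def)
  have hull_closed: "b_closed V F n (hull X)" if "X \<subseteq> V" for X
    unfolding hull_def using VV that by (intro b_closed_Inter) auto
  have hull_mono: "hull X \<subseteq> hull Y" if "X \<subseteq> Y" for X Y
    unfolding hull_def using that by (intro Inter_anti_mono) auto
  let ?r = "|V|"
  let ?D = "\<lambda>\<alpha>. \<Union>\<beta>\<in>underS ?r \<alpha>. hull (underS ?r \<beta>)"
  have "filtration V ?r ?D"
  proof (rule filtration_of_hulls[OF V])
    show "X \<subseteq> hull X \<and> hull X \<subseteq> V" if "X \<subseteq> V" for X
      using VV that unfolding hull_def by blast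
    show "hull X \<subseteq> hull Y" if "X \<subseteq> Y" for X Y by (rule hull_mono[OF that])
    show "|hull X| <o |V|" if X: "X \<subseteq> V" "|X| <o |V|" for X
    proof -
      obtain D where D: "X \<subseteq> D" "|D| <o |V|" "b_closed V F n D" using ex[OF X] by blast
      have "hull X \<subseteq> D" using D(1,3) unfolding hull_def by blast
      then show ?thesis using ordLeq_ordLess_trans[OF card_of_mono1 D(2)] by blast
    qed
  qed
  moreover have "K_closed V F \<mu> (?D \<alpha>)" for \<alpha>
  proof (rule b_closed_imp_K_closed[OF b_closed_chain_Union[OF anti] \<mu>])
    have u: "underS ?r \<beta> \<subseteq> V" for \<beta>
      using FieldI1[of _ \<beta> "|V|"] unfolding Field_card_of underS_def by blast
    show "b_closed V F n C" if "C \<in> (\<lambda>\<beta>. hull (underS ?r \<beta>)) ` underS ?r \<alpha>" for C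
      using that hull_closed[OF u] by blast
    show "C \<subseteq> D \<or> D \<subseteq> C" if C: "C \<in> (\<lambda>\<beta>. hull (underS ?r \<beta>)) ` underS ?r \<alpha>"
      and D: "D \<in> (\<lambda>\<beta>. hull (underS ?r \<beta>)) ` underS ?r \<alpha>" for C D
    proof -
      obtain \<beta> \<gamma> where \<beta>: "C = hull (underS ?r \<beta>)" "\<beta> \<in> underS ?r \<alpha>" and
        \<gamma>: "D = hull (underS ?r \<gamma>)" "\<gamma> \<in> underS ?r \<alpha>" using C D by blast
      have "underS ?r \<beta> \<subseteq> underS ?r \<gamma> \<or> underS ?r \<gamma> \<subseteq> underS ?r \<beta>"
        by (rule underS_chain[OF card_of_Well_order underS_Field[OF \<beta>(2)] underS_Field[OF \<gamma>(2)]])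
      then show ?thesis unfolding \<beta>(1) \<gamma>(1) using hull_mono by blast
    qed
  qed
  ultimately show ?thesis unfolding K_filtrable_def by blast
qed

text \<open>Write \<open>V\<close> as an increasing union of countably many smaller sets and take
  their \<open>K_closed\<close> hulls; these increase and stay smaller than
  \<open>V\<close>.\<close>

lemma K_filtrable_if_cofinality_omega:
  fixes V :: "'a set" and F :: "'a set \<Rightarrow> 'a set" and A :: "nat \<Rightarrow> 'a set"
  assumes V: "infinite V"
    and A: "\<And>n. |A n| <o |V|" "|\<Union>n. A n| =o |V|"
    and ex: "\<And>X. X \<subseteq> V \<Longrightarrow> |X| <o |V| \<Longrightarrow> \<exists>D. X \<subseteq> D \<and> |D| <o |V| \<and> K_closed V F \<mu> D"
  shows "K_filtrable V F \<mu>"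
proof -
  \<comment> \<open>The union of the \<open>A n\<close> only has the right size; \<open>g\<close>
    moves it onto \<open>V\<close>.\<close>
  obtain g where g: "bij_betw g (\<Union>n. A n) V" using A(2) card_of_ordIso[of "\<Union>n. A n" V] by auto
  define B where "B n = g ` (\<Union>i\<le>n. A i)" for n
  have B_V: "B n \<subseteq> V" for n
    using g unfolding B_def bij_betw_def by blast
  have "|\<Union>i\<le>n. A i| <o |V|" for n
  proof (induction n)
    case 0
    then show ?case using A(1) by simp
  next
    case (Suc n)
    then show ?case using card_of_Un_ordLess_infinite[OF V Suc.IH A(1)[of "Suc n"]]
      by (simp add: atMost_Suc Un_commute)
  qed
  then have B_card: "|B n| <o |V|" for n
    unfolding B_def using ordLeq_ordLess_trans[OF card_of_image] by blast
  define C where "C n = \<Inter>{D. B n \<subseteq> D \<and> K_closed V F \<mu> D}" for n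
  have C_ex: "\<exists>D. B n \<subseteq> D \<and> |D| <o |V| \<and> K_closed V F \<mu> D" for n by (rule ex[OF B_V B_card])
  have C_closed: "K_closed V F \<mu> (C n)" for n
    unfolding C_def using C_ex[of n] by (intro K_closed_Inter) auto
  have "\<exists>(\<kappa> :: 'a rel) N. filtration V \<kappa> (\<lambda>\<alpha>. C (N \<alpha>))"
  proof (rule filtration_omega[OF V])
    show "|C n| <o |V|" for n
    proof -
      obtain D where D: "B n \<subseteq> D" "|D| <o |V|" "K_closed V F \<mu> D" using C_ex by blast
      have "C n \<subseteq> D" using D(1,3) unfolding C_def by blast
      then show ?thesis using ordLeq_ordLess_trans[OF card_of_mono1 D(2)] by blast
    qed
    show "C m \<subseteq> C n" if "m \<le> n" for m n
    proof -
      have "(\<Union>i\<le>m. A i) \<subseteq> (\<Union>i\<le>n. A i)" using that by (intro UN_mono) auto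
      then have "B m \<subseteq> B n" unfolding B_def by (rule image_mono)
      then show ?thesis unfolding C_def by (intro Inter_anti_mono) auto
    qed
    show "(\<Union>n. C n) = V"
    proof
      show "(\<Union>n. C n) \<subseteq> V" using C_closed by (auto simp: K_closed_def)
      have "V = g ` (\<Union>n. A n)" using g by (simp add: bij_betw_def)
      also have "\<dots> \<subseteq> (\<Union>n. B n)" unfolding B_def by blast
      also have "\<dots> \<subseteq> (\<Union>n. C n)" unfolding C_def by blast
      finally show "V \<subseteq> (\<Union>n. C n)" .
    qed
  qed
  then show ?thesis unfolding K_filtrable_def using C_closed by blast
qed

end

section \<open>Filtrability from bounded values of \<open>F\<close>\<close>

theorem theorem3p8:
  fixes \<nu> :: "'n rel" and \<mu> :: "'m rel" and \<rho> :: "'r rel"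
    and V :: "'a set" and F :: "'a set \<Rightarrow> 'a set"
  assumes "Cinfinite \<nu>"
    and "is_beth_omega \<nu> \<mu>"
    and "\<mu> <o |V|"
    and "F ` Pow V \<subseteq> Pow V"
    and "antimono_on (Pow V) F"
    and "Card_order \<rho>" and "\<mu> \<le>o \<rho>" and "\<rho> <o |V|"
    and "\<forall>Y \<in> subsets_of_card V \<nu>. |F Y| \<le>o \<rho>"
  shows "K_filtrable V F \<mu>"
proof -
  obtain b :: "nat \<Rightarrow> 'm rel" where b: "\<forall>n. Card_order (b n)" "b 0 =o \<nu>"
    "\<forall>n. b (Suc n) =o ctwo ^c b n" "\<forall>n. b n \<le>o \<mu>"
    using assms(2) unfolding is_beth_omega_def by blast
  interpret beth_sequence b
    using b Cinfinite_cong[OF ordIso_symmetric[OF b(2)] assms(1)] by unfold_locales auto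
  have \<mu>: "\<And>n. b n \<le>o \<mu>" using b(4) by blast
  have F: "F Y \<subseteq> V" if "Y \<subseteq> V" for Y using assms(4) that by blast
  have anti: "F Y \<subseteq> F X" if "X \<subseteq> Y" "Y \<subseteq> V" for X Y
    using monotone_onD[OF assms(5), of X Y] that by auto
  have F_card: "|F Y| \<le>o \<rho>" if "Y \<subseteq> V" "|Y| =o b 0" for Y
    using assms(9) that ordIso_transitive[OF that(2) b(2)] by (simp add: subsets_of_card_def)
  \<comment> \<open>Adding \<open>R\<close> to every \<open>X\<close> makes the set to be closed at
    least as large as \<rho>, hence as all \<open>b n\<close> and all values of \<open>F\<close> on
    sets of size \<nu>.\<close>
  obtain R where R: "R \<subseteq> V" "|R| =o \<rho>"
    using ex_subset_of_card[OF ordLess_imp_ordLeq[OF assms(8)] assms(6)] by blast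
  have \<rho>R: "\<rho> \<le>o |R|" by (rule ordIso_imp_ordLeq[OF ordIso_symmetric[OF R(2)]])
  have "b n \<le>o |R|" for n
    by (rule ordLeq_transitive[OF ordLeq_transitive[OF \<mu> assms(7)] \<rho>R])
  then have "infinite R" by (rule infinite_if_b_ordLeq)
  then have V: "infinite V" using R(1) finite_subset by blast
  have ex: "\<exists>n D. X \<subseteq> D \<and> |D| <o |V| \<and> b_closed V F n D" if X: "X \<subseteq> V" "|X| <o |V|" for X
  proof -
    have "|R \<union> X| <o |V|"
      by (rule card_of_Un_ordLess_infinite[OF V ordIso_ordLess_trans[OF R(2) assms(8)] X(2)])
    moreover have R': "\<rho> \<le>o |R \<union> X|" by (rule ordLeq_transitive[OF \<rho>R card_of_mono1]) blast
    have "\<exists>n D. R \<union> X \<subseteq> D \<and> |D| \<le>o |R \<union> X| \<and> b_closed V F n D"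
    proof (rule ex_b_closed[OF F anti])
      show "|F Y| \<le>o |R \<union> X|" if "Y \<subseteq> V" "|Y| =o b 0" for Y
        by (rule ordLeq_transitive[OF F_card[OF that] R'])
      show "b n \<le>o |R \<union> X|" for n
        by (rule ordLeq_transitive[OF ordLeq_transitive[OF \<mu> assms(7)] R'])
    qed (use R(1) X(1) in auto)
    ultimately show ?thesis using ordLeq_ordLess_trans by blast
  qed
  show ?thesis
  proof (cases "\<exists>n. \<forall>X. X \<subseteq> V \<and> |X| <o |V| \<longrightarrow> (\<exists>D. X \<subseteq> D \<and> |D| <o |V| \<and> b_closed V F n D)")
    case True
    then obtain n where
      n: "\<forall>X. X \<subseteq> V \<and> |X| <o |V| \<longrightarrow> (\<exists>D. X \<subseteq> D \<and> |D| <o |V| \<and> b_closed V F n D)" ..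
    show ?thesis
    proof (rule K_filtrable_if_uniform[OF V F anti \<mu>])
      show "\<exists>D. X \<subseteq> D \<and> |D| <o |V| \<and> b_closed V F n D" if "X \<subseteq> V" "|X| <o |V|" for X
        by (rule mp[OF spec[OF n] conjI[OF that]])
    qed
  next
    case False
    then have "\<forall>n. \<exists>X. X \<subseteq> V \<and> |X| <o |V| \<and> \<not> (\<exists>D. X \<subseteq> D \<and> |D| <o |V| \<and> b_closed V F n D)"
      by simp
    from choice[OF this] obtain A where
      "\<forall>n. A n \<subseteq> V \<and> |A n| <o |V| \<and> \<not> (\<exists>D. A n \<subseteq> D \<and> |D| <o |V| \<and> b_closed V F n D)" ..
    from spec[OF this] have A: "A n \<subseteq> V" "|A n| <o |V|"
      "\<not> (\<exists>D. A n \<subseteq> D \<and> |D| <o |V| \<and> b_closed V F n D)" for n by blast+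
    \<comment> \<open>Were the union smaller than \<open>V\<close>, it would have a smaller closed
      superset at some index \<open>n\<close>, contrary to the choice of \<open>A n\<close>. So
      \<open>|V|\<close> is reached by countably many smaller sets.\<close>
    have "\<not> |\<Union>n. A n| <o |V|"
    proof
      assume "|\<Union>n. A n| <o |V|"
      then obtain n D where D: "(\<Union>n. A n) \<subseteq> D" "|D| <o |V|" "b_closed V F n D"
        using ex[of "\<Union>n. A n"] A(1) by blast
      then have "A n \<subseteq> D" by blast
      then show False using A(3)[of n] D(2,3) by blast
    qed
    then have "|V| \<le>o |\<Union>n. A n|" using card_not_ordLeq_iff by blast
    moreover have "|\<Union>n. A n| \<le>o |V|" using A(1) by (intro card_of_mono1) blast
    ultimately have "|\<Union>n. A n| =o |V|" by (simp add: ordIso_iff_ordLeq)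
    then show ?thesis
    proof (rule K_filtrable_if_cofinality_omega[OF V A(2)])
      show "\<exists>D. X \<subseteq> D \<and> |D| <o |V| \<and> K_closed V F \<mu> D" if "X \<subseteq> V" "|X| <o |V|" for X
        using ex[OF that] b_closed_imp_K_closed[OF _ \<mu>] by blast
    qed
  qed
qed

end
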